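(* Let $(\mathcal T,\otimes,\mathbf 1)$ be a tensor triangulated category with a preaisle $\mathcal T^{\leq 0}$ such that $\mathcal T^{\leq 0}\otimes\mathcal T^{\leq 0}\subset\mathcal T^{\leq 0}$, $\mathbf 1\in\mathcal T^{\leq 0}$ and $\langle\mathcal T^{\leq 0}\rangle=\mathcal T$. If $(\mathcal U,\mathcal V[1])$ is a stable t-structure on $\mathcal T$, then the following are equivalent: (1) $(\mathcal U,\mathcal V[1])$ is a stable tensor t-structure on $\mathcal T$. (2) The aisle $\mathcal U$ is a $\otimes$-ideal of $\mathcal T$. (3) The coaisle $\mathcal V$ is a coideal of $\mathcal T$.
   Context: Triangulated categories are assumed to have all small coproducts. A tensor triangulated category $(\mathcal T,\otimes,\mathbf 1)$ is a triangulated category with a compatible closed symmetric monoidal structure: $\otimes$ is triangulated in both variables, each $-\otimes B$ has a right adjoint $\mathscr{H}om(B,-)$, and $\mathscr{H}om(-,-)$ is triangulated in both variables. $\langle\mathcal S\rangle$ denotes the smallest localizing subcategory (triangulated subcategory closed under direct summands and small coproducts) containing $\mathcal S$. A preaisle is a full subcategory closed under positive shifts and extensions. A t-structure is written $(\mathcal U,\mathcal V[1])$ with aisle $\mathcal U$ and coaisle $\mathcal V=\mathcal U^\perp=\{B\mid\mathrm{Hom}(A,B)=0\ \forall A\in\mathcal U\}$. It is stable if $\mathcal U$ is closed under negative shifts. It is a tensor t-structure (with respect to $\mathcal T^{\leq 0}$) if $\mathcal T^{\leq 0}\otimes\mathcal U\subset\mathcal U$. A thick subcategory (triangulated subcategory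 closed under direct summands) $\mathcal C$ of $\mathcal T$ is a $\otimes$-ideal if $\mathcal T\otimes\mathcal C\subset\mathcal C$, and a coideal if $\mathscr{H}om(\mathcal T,\mathcal C)\subset\mathcal C$. *)

theory Defs
  imports Main "HOL-Algebra.Group"
begin

section \<open>Categories, functors, natural isomorphisms\<close>

text \<open>Categories have a set of objects and a set of arrows inside arbitrary types.
  Functions and records are only constrained on these carriers.\<close>

record ('o, 'm) cat =
  Obj :: "'o set"
  Arr :: "'m set"
  Dom :: "'m \<Rightarrow> 'o"
  Cod :: "'m \<Rightarrow> 'o"
  Idn :: "'o \<Rightarrow> 'm"
  Cmp :: "'m \<Rightarrow> 'm \<Rightarrow> 'm"  (infixl "\<cdot>\<index>" 75)

definition arrs :: "('o, 'm, 'z) cat_scheme \<Rightarrow> 'o \<Rightarrow> 'o \<Rightarrow> 'm set" where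
  "arrs C A B = {f \<in> Arr C. Dom C f = A \<and> Cod C f = B}"

locale category =
  fixes C :: "('o, 'm, 'z) cat_scheme" (structure)
  assumes dom_obj: "f \<in> Arr C \<Longrightarrow> Dom C f \<in> Obj C"
    and cod_obj: "f \<in> Arr C \<Longrightarrow> Cod C f \<in> Obj C"
    and idn_arr: "A \<in> Obj C \<Longrightarrow> Idn C A \<in> arrs C A A"
    and cmp_arr: "\<lbrakk>f \<in> arrs C A B; g \<in> arrs C B D\<rbrakk> \<Longrightarrow> g \<cdot> f \<in> arrs C A D"
    and cmp_idn_right: "f \<in> arrs C A B \<Longrightarrow> f \<cdot> Idn C A = f"
    and cmp_idn_left: "f \<in> arrs C A B \<Longrightarrow> Idn C B \<cdot> f = f"
    and cmp_assoc: "\<lbrakk>f \<in> arrs C A B; g \<in> arrs C B D; h \<in> arrs C D E\<rbrakk>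
        \<Longrightarrow> (h \<cdot> g) \<cdot> f = h \<cdot> (g \<cdot> f)"

definition op_cat :: "('o, 'm, 'z) cat_scheme \<Rightarrow> ('o, 'm) cat" where
  "op_cat C = \<lparr>Obj = Obj C, Arr = Arr C, Dom = Cod C, Cod = Dom C, Idn = Idn C,
     Cmp = (\<lambda>g f. f \<cdot>\<^bsub>C\<^esub> g)\<rparr>"

definition prod_cat :: "('o, 'm, 'z) cat_scheme \<Rightarrow> ('p, 'n, 'y) cat_scheme \<Rightarrow> ('o \<times> 'p, 'm \<times> 'n) cat"
  where
  "prod_cat C D = \<lparr>Obj = Obj C \<times> Obj D, Arr = Arr C \<times> Arr D,
     Dom = map_prod (Dom C) (Dom D), Cod = map_prod (Cod C) (Cod D),
     Idn = map_prod (Idn C) (Idn D),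
     Cmp = (\<lambda>(g, g') (f, f'). (g \<cdot>\<^bsub>C\<^esub> f, g' \<cdot>\<^bsub>D\<^esub> f'))\<rparr>"

definition is_iso :: "('o, 'm, 'z) cat_scheme \<Rightarrow> 'm \<Rightarrow> bool" where
  "is_iso C f \<longleftrightarrow> f \<in> Arr C \<and>
     (\<exists>g \<in> arrs C (Cod C f) (Dom C f).
        g \<cdot>\<^bsub>C\<^esub> f = Idn C (Dom C f) \<and> f \<cdot>\<^bsub>C\<^esub> g = Idn C (Cod C f))"

definition isomorphic :: "('o, 'm, 'z) cat_scheme \<Rightarrow> 'o \<Rightarrow> 'o \<Rightarrow> bool" where
  "isomorphic C A B \<longleftrightarrow> (\<exists>f \<in> arrs C A B. is_iso C f)"

record ('o, 'm, 'p, 'n) fctr =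
  ob :: "'o \<Rightarrow> 'p"
  ar :: "'m \<Rightarrow> 'n"

definition is_functor ::
  "('o, 'm, 'z) cat_scheme \<Rightarrow> ('p, 'n, 'y) cat_scheme \<Rightarrow> ('o, 'm, 'p, 'n) fctr \<Rightarrow> bool" where
  "is_functor C D F \<longleftrightarrow>
     (\<forall>A \<in> Obj C. ob F A \<in> Obj D) \<and>
     (\<forall>f \<in> Arr C. ar F f \<in> arrs D (ob F (Dom C f)) (ob F (Cod C f))) \<and>
     (\<forall>A \<in> Obj C. ar F (Idn C A) = Idn D (ob F A)) \<and>
     (\<forall>f \<in> Arr C. \<forall>g \<in> Arr C. Cod C f = Dom C g \<longrightarrow>
        ar F (g \<cdot>\<^bsub>C\<^esub> f) = ar F g \<cdot>\<^bsub>D\<^esub> ar F f)"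

definition id_fctr :: "('o, 'm, 'o, 'm) fctr" where
  "id_fctr = \<lparr>ob = id, ar = id\<rparr>"

definition comp_fctr ::
  "('p, 'n, 'q, 'k) fctr \<Rightarrow> ('o, 'm, 'p, 'n) fctr \<Rightarrow> ('o, 'm, 'q, 'k) fctr" where
  "comp_fctr G F = \<lparr>ob = ob G \<circ> ob F, ar = ar G \<circ> ar F\<rparr>"

definition nat_iso ::
  "('o, 'm, 'z) cat_scheme \<Rightarrow> ('p, 'n, 'y) cat_scheme \<Rightarrow>
   ('o, 'm, 'p, 'n) fctr \<Rightarrow> ('o, 'm, 'p, 'n) fctr \<Rightarrow> ('o \<Rightarrow> 'n) \<Rightarrow> bool" where
  "nat_iso C D F G \<eta> \<longleftrightarrow> is_functor C D F \<and> is_functor C D G \<and>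
     (\<forall>A \<in> Obj C. \<eta> A \<in> arrs D (ob F A) (ob G A) \<and> is_iso D (\<eta> A)) \<and>
     (\<forall>f \<in> Arr C. \<eta> (Cod C f) \<cdot>\<^bsub>D\<^esub> ar F f = ar G f \<cdot>\<^bsub>D\<^esub> \<eta> (Dom C f))"

section \<open>Coproducts\<close>

definition is_coproduct ::
  "('o, 'm, 'z) cat_scheme \<Rightarrow> 'i set \<Rightarrow> ('i \<Rightarrow> 'o) \<Rightarrow> 'o \<Rightarrow> ('i \<Rightarrow> 'm) \<Rightarrow> bool" where
  "is_coproduct C I X S \<iota> \<longleftrightarrow>
     S \<in> Obj C \<and> (\<forall>i \<in> I. X i \<in> Obj C \<and> \<iota> i \<in> arrs C (X i) S) \<and>
     (\<forall>Z \<in> Obj C. \<forall>f. (\<forall>i \<in> I. f i \<in> arrs C (X i) Z) \<longrightarrow>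
        (\<exists>!h. h \<in> arrs C S Z \<and> (\<forall>i \<in> I. h \<cdot>\<^bsub>C\<^esub> \<iota> i = f i)))"

abbreviation is_binary_coproduct ::
  "('o, 'm, 'z) cat_scheme \<Rightarrow> 'o \<Rightarrow> 'o \<Rightarrow> 'o \<Rightarrow> (bool \<Rightarrow> 'm) \<Rightarrow> bool" where
  "is_binary_coproduct C A B \<equiv> is_coproduct C UNIV (\<lambda>b. if b then A else B)"

text \<open>HOL has no distinguished universe of small sets.  The class of small index sets is therefore
  a parameter: a collection of subsets of some type that contains an infinite set and is closed
  under subsets of images and under small unions.  The small sets of any Grothendieck universe
  with an infinite element, or the sets of cardinality less than an uncountable regular cardinal, are of this form.\<close>

definition small_index_sets :: "'i set set \<Rightarrow> bool" where
  "small_index_sets \<K> \<longleftrightarrow>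
     (\<exists>I \<in> \<K>. infinite I) \<and>
     (\<forall>I \<in> \<K>. \<forall>g J. J \<subseteq> g ` I \<longrightarrow> J \<in> \<K>) \<and>
     (\<forall>I \<in> \<K>. \<forall>J. (\<forall>i \<in> I. J i \<in> \<K>) \<longrightarrow> (\<Union>i \<in> I. J i) \<in> \<K>)"

definition has_small_coproducts :: "'i set set \<Rightarrow> ('o, 'm, 'z) cat_scheme \<Rightarrow> bool" where
  "has_small_coproducts \<K> C \<longleftrightarrow>
     (\<forall>I \<in> \<K>. \<forall>X. (\<forall>i \<in> I. X i \<in> Obj C) \<longrightarrow> (\<exists>S \<iota>. is_coproduct C I X S \<iota>))"

section \<open>Additive categories\<close>

record ('o, 'm) add_cat = "('o, 'm) cat" +
  Add :: "'m \<Rightarrow> 'm \<Rightarrow> 'm"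
  Zer :: "'o \<Rightarrow> 'o \<Rightarrow> 'm"

definition hom_group :: "('o, 'm, 'z) add_cat_scheme \<Rightarrow> 'o \<Rightarrow> 'o \<Rightarrow> 'm monoid" where
  "hom_group C A B = \<lparr>carrier = arrs C A B, monoid.mult = Add C, one = Zer C A B\<rparr>"

definition neg :: "('o, 'm, 'z) add_cat_scheme \<Rightarrow> 'm \<Rightarrow> 'm" where
  "neg C f = inv\<^bsub>hom_group C (Dom C f) (Cod C f)\<^esub> f"

definition zero_object :: "('o, 'm, 'z) cat_scheme \<Rightarrow> 'o \<Rightarrow> bool" where
  "zero_object C Z \<longleftrightarrow> Z \<in> Obj C \<and>
     (\<forall>A \<in> Obj C. (\<exists>!f. f \<in> arrs C Z A) \<and> (\<exists>!f. f \<in> arrs C A Z))"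

locale additive_category = category C
  for C :: "('o, 'm, 'z) add_cat_scheme" (structure) +
  assumes hom_comm_group: "\<lbrakk>A \<in> Obj C; B \<in> Obj C\<rbrakk> \<Longrightarrow> comm_group (hom_group C A B)"
    and cmp_add_left: "\<lbrakk>f \<in> arrs C A B; g \<in> arrs C B D; h \<in> arrs C B D\<rbrakk>
        \<Longrightarrow> Add C g h \<cdot> f = Add C (g \<cdot> f) (h \<cdot> f)"
    and cmp_add_right: "\<lbrakk>f \<in> arrs C A B; g \<in> arrs C A B; h \<in> arrs C B D\<rbrakk>
        \<Longrightarrow> h \<cdot> Add C f g = Add C (h \<cdot> f) (h \<cdot> g)"
    and ex_zero_object: "\<exists>Z. zero_object C Z"
    and ex_binary_coproduct: "\<lbrakk>A \<in> Obj C; B \<in> Obj C\<rbrakk> \<Longrightarrow> \<exists>S \<iota>. is_binary_coproduct C A B S \<iota>"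

text \<open>The condition only concerns the effect on parallel arrows, so it also applies to
  contravariant functors.\<close>

definition preserves_sums ::
  "('o, 'm, 'z) add_cat_scheme \<Rightarrow> ('p, 'n, 'y) add_cat_scheme \<Rightarrow> ('o, 'm, 'p, 'n) fctr \<Rightarrow> bool" where
  "preserves_sums C D F \<longleftrightarrow>
     (\<forall>A \<in> Obj C. \<forall>B \<in> Obj C. \<forall>f \<in> arrs C A B. \<forall>g \<in> arrs C A B.
        ar F (Add C f g) = Add D (ar F f) (ar F g))"

section \<open>Triangulated categories\<close>

text \<open>The shift \<open>[1]\<close> is an additive autoequivalence \<open>Shift\<close> given together with a quasi-inverse
  \<open>Unshift\<close>, written \<open>[-1]\<close>; it need not be a strict automorphism.  A distinguished triangle
  \<open>X \<rightarrow> Y \<rightarrow> Z \<rightarrow> X[1]\<close> is the triple of its arrows.\<close>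

record ('o, 'm) tri_cat = "('o, 'm) add_cat" +
  Shift :: "('o, 'm, 'o, 'm) fctr"
  Unshift :: "('o, 'm, 'o, 'm) fctr"
  Dist :: "('m \<times> 'm \<times> 'm) set"

definition triangle :: "('o, 'm, 'z) tri_cat_scheme \<Rightarrow> 'm \<Rightarrow> 'm \<Rightarrow> 'm \<Rightarrow> bool" where
  "triangle T u v w \<longleftrightarrow> u \<in> Arr T \<and> v \<in> Arr T \<and> w \<in> Arr T \<and>
     Cod T u = Dom T v \<and> Cod T v = Dom T w \<and> Cod T w = ob (Shift T) (Dom T u)"

definition triangle_morphism ::
  "('o, 'm, 'z) tri_cat_scheme \<Rightarrow> 'm \<times> 'm \<times> 'm \<Rightarrow> 'm \<times> 'm \<times> 'm \<Rightarrow> 'm \<times> 'm \<times> 'm \<Rightarrow> bool" where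
  "triangle_morphism T = (\<lambda>(u, v, w) (u', v', w') (a, b, c).
     a \<in> arrs T (Dom T u) (Dom T u') \<and>
     b \<in> arrs T (Dom T v) (Dom T v') \<and>
     c \<in> arrs T (Dom T w) (Dom T w') \<and>
     b \<cdot>\<^bsub>T\<^esub> u = u' \<cdot>\<^bsub>T\<^esub> a \<and>
     c \<cdot>\<^bsub>T\<^esub> v = v' \<cdot>\<^bsub>T\<^esub> b \<and>
     ar (Shift T) a \<cdot>\<^bsub>T\<^esub> w = w' \<cdot>\<^bsub>T\<^esub> c)"

locale triangulated_category = additive_category T
  for T :: "('o, 'm, 'z) tri_cat_scheme" (structure) +
  assumes shift_functor: "is_functor T T (Shift T)"
    and shift_additive: "preserves_sums T T (Shift T)"
    and unshift_functor: "is_functor T T (Unshift T)"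
    and unshift_shift: "\<exists>\<eta>. nat_iso T T id_fctr (comp_fctr (Unshift T) (Shift T)) \<eta>"
    and shift_unshift: "\<exists>\<epsilon>. nat_iso T T (comp_fctr (Shift T) (Unshift T)) id_fctr \<epsilon>"
    and dist_triangle: "(u, v, w) \<in> Dist T \<Longrightarrow> triangle T u v w"
    and dist_iso: "\<lbrakk>(u, v, w) \<in> Dist T; triangle T u' v' w';
          triangle_morphism T (u, v, w) (u', v', w') (a, b, c);
          is_iso T a; is_iso T b; is_iso T c\<rbrakk> \<Longrightarrow> (u', v', w') \<in> Dist T"
    and TR1_idn: "\<lbrakk>X \<in> Obj T; zero_object T Z\<rbrakk>
        \<Longrightarrow> (Idn T X, Zer T X Z, Zer T Z (ob (Shift T) X)) \<in> Dist T"
    and TR1_cone: "u \<in> Arr T \<Longrightarrow> \<exists>v w. (u, v, w) \<in> Dist T"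
    and TR2: "triangle T u v w
        \<Longrightarrow> (u, v, w) \<in> Dist T \<longleftrightarrow> (v, w, neg T (ar (Shift T) u)) \<in> Dist T"
    and TR3: "\<lbrakk>(u, v, w) \<in> Dist T; (u', v', w') \<in> Dist T;
          a \<in> arrs T (Dom T u) (Dom T u'); b \<in> arrs T (Dom T v) (Dom T v');
          b \<cdot> u = u' \<cdot> a\<rbrakk>
        \<Longrightarrow> \<exists>c. triangle_morphism T (u, v, w) (u', v', w') (a, b, c)"
    and TR4: "\<lbrakk>(u, j, k) \<in> Dist T; (v, l, i) \<in> Dist T; Cod T u = Dom T v;
          (v \<cdot> u, m, n) \<in> Dist T\<rbrakk>
        \<Longrightarrow> \<exists>f \<in> arrs T (Cod T j) (Cod T m). \<exists>g \<in> arrs T (Cod T m) (Cod T l).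
              (f, g, ar (Shift T) j \<cdot> i) \<in> Dist T \<and>
              f \<cdot> j = m \<cdot> v \<and> n \<cdot> f = k \<and> g \<cdot> m = l \<and> i \<cdot> g = ar (Shift T) u \<cdot> n"

definition triangulated_functor ::
  "('o, 'm, 'z) tri_cat_scheme \<Rightarrow> ('p, 'n, 'y) tri_cat_scheme \<Rightarrow> ('o, 'm, 'p, 'n) fctr \<Rightarrow> bool" where
  "triangulated_functor S T F \<longleftrightarrow> is_functor S T F \<and> preserves_sums S T F \<and>
     (\<exists>\<phi>. nat_iso S T (comp_fctr F (Shift S)) (comp_fctr (Shift T) F) \<phi> \<and>
        (\<forall>(u, v, w) \<in> Dist S. (ar F u, ar F v, \<phi> (Dom S u) \<cdot>\<^bsub>T\<^esub> ar F w) \<in> Dist T))"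

text \<open>A contravariant triangulated functor sends \<open>X \<rightarrow> Y \<rightarrow> Z \<rightarrow> X[1]\<close> to
  \<open>F Z \<rightarrow> F Y \<rightarrow> F X \<rightarrow> (F Z)[1]\<close>, where the last arrow uses a natural isomorphism
  \<open>F X \<cong> (F (X[1]))[1]\<close>.  Replacing this isomorphism by its negative changes the sign of the last
  arrow, so no sign convention for the opposite triangulated category is involved.\<close>

definition contra_triangulated_functor ::
  "('o, 'm, 'z) tri_cat_scheme \<Rightarrow> ('p, 'n, 'y) tri_cat_scheme \<Rightarrow> ('o, 'm, 'p, 'n) fctr \<Rightarrow> bool" where
  "contra_triangulated_functor S T F \<longleftrightarrow> is_functor (op_cat S) T F \<and> preserves_sums S T F \<and>
     (\<exists>\<phi>. nat_iso (op_cat S) T F (comp_fctr (Shift T) (comp_fctr F (Shift S))) \<phi> \<and>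
        (\<forall>(u, v, w) \<in> Dist S.
           (ar F v, ar F u, ar (Shift T) (ar F w) \<cdot>\<^bsub>T\<^esub> \<phi> (Dom S u)) \<in> Dist T))"

section \<open>Tensor triangulated categories\<close>

text \<open>\<open>Assoc A B D : (A \<otimes> B) \<otimes> D \<rightarrow> A \<otimes> (B \<otimes> D)\<close>, \<open>LUnit A : \<one> \<otimes> A \<rightarrow> A\<close>, \<open>RUnit A : A \<otimes> \<one> \<rightarrow> A\<close>,
  \<open>Symm A B : A \<otimes> B \<rightarrow> B \<otimes> A\<close>, and \<open>Curry A B D\<close> is the adjunction bijection from
  arrows \<open>A \<otimes> B \<rightarrow> D\<close> to arrows \<open>A \<rightarrow> Hom(B, D)\<close>.\<close>

record ('o, 'm) tt_cat = "('o, 'm) tri_cat" +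
  Tensor :: "('o \<times> 'o, 'm \<times> 'm, 'o, 'm) fctr"
  Unit :: 'o
  Assoc :: "'o \<Rightarrow> 'o \<Rightarrow> 'o \<Rightarrow> 'm"
  LUnit :: "'o \<Rightarrow> 'm"
  RUnit :: "'o \<Rightarrow> 'm"
  Symm :: "'o \<Rightarrow> 'o \<Rightarrow> 'm"
  IHom :: "('o \<times> 'o, 'm \<times> 'm, 'o, 'm) fctr"
  Curry :: "'o \<Rightarrow> 'o \<Rightarrow> 'o \<Rightarrow> 'm \<Rightarrow> 'm"

abbreviation tens :: "('o, 'm, 'z) tt_cat_scheme \<Rightarrow> 'o \<Rightarrow> 'o \<Rightarrow> 'o"  (infixr "\<boxtimes>\<index>" 72) where
  "A \<boxtimes>\<^bsub>T\<^esub> B \<equiv> ob (Tensor T) (A, B)"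

abbreviation tens_ar :: "('o, 'm, 'z) tt_cat_scheme \<Rightarrow> 'm \<Rightarrow> 'm \<Rightarrow> 'm"  (infixr "\<boxdot>\<index>" 80) where
  "f \<boxdot>\<^bsub>T\<^esub> g \<equiv> ar (Tensor T) (f, g)"

abbreviation ihom :: "('o, 'm, 'z) tt_cat_scheme \<Rightarrow> 'o \<Rightarrow> 'o \<Rightarrow> 'o" where
  "ihom T A B \<equiv> ob (IHom T) (A, B)"

abbreviation fix_left :: "'a \<Rightarrow> 'b \<Rightarrow> ('a \<times> 'o, 'b \<times> 'm, 'p, 'n) fctr \<Rightarrow> ('o, 'm, 'p, 'n) fctr" where
  "fix_left A i F \<equiv> \<lparr>ob = (\<lambda>X. ob F (A, X)), ar = (\<lambda>f. ar F (i, f))\<rparr>"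

abbreviation fix_right :: "'a \<Rightarrow> 'b \<Rightarrow> ('o \<times> 'a, 'm \<times> 'b, 'p, 'n) fctr \<Rightarrow> ('o, 'm, 'p, 'n) fctr" where
  "fix_right A i F \<equiv> \<lparr>ob = (\<lambda>X. ob F (X, A)), ar = (\<lambda>f. ar F (f, i))\<rparr>"

locale symmetric_monoidal = category T
  for T :: "('o, 'm, 'z) tt_cat_scheme" (structure) +
  assumes tensor_functor: "is_functor (prod_cat T T) T (Tensor T)"
    and unit_obj: "Unit T \<in> Obj T"
    and assoc_nat_iso: "nat_iso (prod_cat (prod_cat T T) T) T
          \<lparr>ob = (\<lambda>((A, B), D). (A \<boxtimes> B) \<boxtimes> D), ar = (\<lambda>((f, g), h). (f \<boxdot> g) \<boxdot> h)\<rparr>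
          \<lparr>ob = (\<lambda>((A, B), D). A \<boxtimes> (B \<boxtimes> D)), ar = (\<lambda>((f, g), h). f \<boxdot> (g \<boxdot> h))\<rparr>
          (\<lambda>((A, B), D). Assoc T A B D)"
    and lunit_nat_iso:
        "nat_iso T T (fix_left (Unit T) (Idn T (Unit T)) (Tensor T)) id_fctr (LUnit T)"
    and runit_nat_iso:
        "nat_iso T T (fix_right (Unit T) (Idn T (Unit T)) (Tensor T)) id_fctr (RUnit T)"
    and symm_nat_iso: "nat_iso (prod_cat T T) T (Tensor T)
          \<lparr>ob = (\<lambda>(A, B). B \<boxtimes> A), ar = (\<lambda>(f, g). g \<boxdot> f)\<rparr>
          (\<lambda>(A, B). Symm T A B)"
    and pentagon: "\<lbrakk>A \<in> Obj T; B \<in> Obj T; D \<in> Obj T; E \<in> Obj T\<rbrakk>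
        \<Longrightarrow> (Idn T A \<boxdot> Assoc T B D E) \<cdot> Assoc T A (B \<boxtimes> D) E \<cdot> (Assoc T A B D \<boxdot> Idn T E) =
            Assoc T A B (D \<boxtimes> E) \<cdot> Assoc T (A \<boxtimes> B) D E"
    and unit_coherence: "\<lbrakk>A \<in> Obj T; B \<in> Obj T\<rbrakk>
        \<Longrightarrow> (Idn T A \<boxdot> LUnit T B) \<cdot> Assoc T A (Unit T) B = RUnit T A \<boxdot> Idn T B"
    and symmetry: "\<lbrakk>A \<in> Obj T; B \<in> Obj T\<rbrakk> \<Longrightarrow> Symm T B A \<cdot> Symm T A B = Idn T (A \<boxtimes> B)"
    and hexagon: "\<lbrakk>A \<in> Obj T; B \<in> Obj T; D \<in> Obj T\<rbrakk>
        \<Longrightarrow> Assoc T B D A \<cdot> Symm T A (B \<boxtimes> D) \<cdot> Assoc T A B D =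
            (Idn T B \<boxdot> Symm T A D) \<cdot> Assoc T B A D \<cdot> (Symm T A B \<boxdot> Idn T D)"

text \<open>Naturality of \<open>Curry\<close> in its last two object arguments determines the action of
  \<open>IHom\<close> on arrows.\<close>

locale closed_symmetric_monoidal = symmetric_monoidal T
  for T :: "('o, 'm, 'z) tt_cat_scheme" (structure) +
  assumes ihom_functor: "is_functor (prod_cat (op_cat T) T) T (IHom T)"
    and curry_bij: "\<lbrakk>A \<in> Obj T; B \<in> Obj T; D \<in> Obj T\<rbrakk>
        \<Longrightarrow> bij_betw (Curry T A B D) (arrs T (A \<boxtimes> B) D) (arrs T A (ihom T B D))"
    and curry_natural: "\<lbrakk>a \<in> arrs T A' A; b \<in> arrs T B' B; d \<in> arrs T D D'; f \<in> arrs T (A \<boxtimes> B) D\<rbrakk>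
        \<Longrightarrow> Curry T A' B' D' (d \<cdot> f \<cdot> (a \<boxdot> b)) = ar (IHom T) (b, d) \<cdot> Curry T A B D f \<cdot> a"

locale tensor_triangulated_category = triangulated_category T + closed_symmetric_monoidal T
  for \<K> :: "'i set set" and T :: "('o, 'm, 'z) tt_cat_scheme" (structure) +
  assumes small_coproducts: "has_small_coproducts \<K> T"
    and tensor_triangulated_left:
        "B \<in> Obj T \<Longrightarrow> triangulated_functor T T (fix_right B (Idn T B) (Tensor T))"
    and tensor_triangulated_right:
        "A \<in> Obj T \<Longrightarrow> triangulated_functor T T (fix_left A (Idn T A) (Tensor T))"
    and ihom_triangulated_left:
        "B \<in> Obj T \<Longrightarrow> contra_triangulated_functor T T (fix_right B (Idn T B) (IHom T))"
    and ihom_triangulated_right: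
        "A \<in> Obj T \<Longrightarrow> triangulated_functor T T (fix_left A (Idn T A) (IHom T))"

section \<open>Full subcategories\<close>

text \<open>A full subcategory is given by its set of objects.\<close>

definition replete :: "('o, 'm, 'z) cat_scheme \<Rightarrow> 'o set \<Rightarrow> bool" where
  "replete C S \<longleftrightarrow> S \<subseteq> Obj C \<and> (\<forall>A \<in> S. \<forall>B \<in> Obj C. isomorphic C A B \<longrightarrow> B \<in> S)"

definition shift_sub :: "('o, 'm, 'z) tri_cat_scheme \<Rightarrow> 'o set \<Rightarrow> 'o set" where
  "shift_sub T S = {Y \<in> Obj T. \<exists>X \<in> S. isomorphic T (ob (Shift T) X) Y}"

definition unshift_sub :: "('o, 'm, 'z) tri_cat_scheme \<Rightarrow> 'o set \<Rightarrow> 'o set" where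
  "unshift_sub T S = {Y \<in> Obj T. \<exists>X \<in> S. isomorphic T (ob (Unshift T) X) Y}"

definition extension_closed :: "('o, 'm, 'z) tri_cat_scheme \<Rightarrow> 'o set \<Rightarrow> bool" where
  "extension_closed T S \<longleftrightarrow>
     (\<forall>(u, v, w) \<in> Dist T. Dom T u \<in> S \<and> Cod T v \<in> S \<longrightarrow> Dom T v \<in> S)"

definition preaisle :: "('o, 'm, 'z) tri_cat_scheme \<Rightarrow> 'o set \<Rightarrow> bool" where
  "preaisle T S \<longleftrightarrow> S \<subseteq> Obj T \<and> (\<forall>X \<in> S. ob (Shift T) X \<in> S) \<and> extension_closed T S"

definition triangulated_sub :: "('o, 'm, 'z) tri_cat_scheme \<Rightarrow> 'o set \<Rightarrow> bool" where
  "triangulated_sub T S \<longleftrightarrow> replete T S \<and> (\<exists>Z \<in> S. zero_object T Z) \<and>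
     (\<forall>X \<in> S. ob (Shift T) X \<in> S \<and> ob (Unshift T) X \<in> S) \<and>
     (\<forall>(u, v, w) \<in> Dist T. Dom T u \<in> S \<and> Cod T u \<in> S \<longrightarrow> Cod T v \<in> S)"

definition summand_closed :: "('o, 'm, 'z) cat_scheme \<Rightarrow> 'o set \<Rightarrow> bool" where
  "summand_closed C S \<longleftrightarrow> (\<forall>X \<in> S. \<forall>A B \<iota>. is_binary_coproduct C A B X \<iota> \<longrightarrow> A \<in> S)"

definition coproduct_closed :: "'i set set \<Rightarrow> ('o, 'm, 'z) cat_scheme \<Rightarrow> 'o set \<Rightarrow> bool" where
  "coproduct_closed \<K> C S \<longleftrightarrow>
     (\<forall>I \<in> \<K>. \<forall>X Y \<iota>. (\<forall>i \<in> I. X i \<in> S) \<and> is_coproduct C I X Y \<iota> \<longrightarrow> Y \<in> S)"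

definition thick :: "('o, 'm, 'z) tri_cat_scheme \<Rightarrow> 'o set \<Rightarrow> bool" where
  "thick T S \<longleftrightarrow> triangulated_sub T S \<and> summand_closed T S"

definition localizing :: "'i set set \<Rightarrow> ('o, 'm, 'z) tri_cat_scheme \<Rightarrow> 'o set \<Rightarrow> bool" where
  "localizing \<K> T S \<longleftrightarrow> triangulated_sub T S \<and> summand_closed T S \<and> coproduct_closed \<K> T S"

definition localizing_hull :: "'i set set \<Rightarrow> ('o, 'm, 'z) tri_cat_scheme \<Rightarrow> 'o set \<Rightarrow> 'o set" where
  "localizing_hull \<K> T S = \<Inter> {L. localizing \<K> T L \<and> S \<subseteq> L}"

section \<open>t-structures, tensor ideals and coideals\<close>

definition right_orth :: "('o, 'm, 'z) add_cat_scheme \<Rightarrow> 'o set \<Rightarrow> 'o set" where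
  "right_orth C U = {B \<in> Obj C. \<forall>A \<in> U. arrs C A B = {Zer C A B}}"

text \<open>In \<open>t_structure T U W\<close>, the pair \<open>(U, W)\<close> plays the role of
  \<open>(D\<^sup>\<le>\<^sup>0, D\<^sup>\<ge>\<^sup>0)\<close>, so that \<open>D\<^sup>\<ge>\<^sup>1\<close> is \<open>W[-1]\<close>.\<close>

definition t_structure :: "('o, 'm, 'z) tri_cat_scheme \<Rightarrow> 'o set \<Rightarrow> 'o set \<Rightarrow> bool" where
  "t_structure T U W \<longleftrightarrow> replete T U \<and> replete T W \<and>
     shift_sub T U \<subseteq> U \<and> unshift_sub T W \<subseteq> W \<and>
     (\<forall>A \<in> U. \<forall>B \<in> unshift_sub T W. arrs T A B = {Zer T A B}) \<and>
     (\<forall>X \<in> Obj T. \<exists>(u, v, w) \<in> Dist T. Dom T u \<in> U \<and> Dom T v = X \<and> Cod T v \<in> unshift_sub T W)"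

definition stable_t_structure :: "('o, 'm, 'z) tri_cat_scheme \<Rightarrow> 'o set \<Rightarrow> 'o set \<Rightarrow> bool" where
  "stable_t_structure T U W \<longleftrightarrow> t_structure T U W \<and> unshift_sub T U \<subseteq> U"

definition tensor_t_structure ::
  "('o, 'm, 'z) tt_cat_scheme \<Rightarrow> 'o set \<Rightarrow> 'o set \<Rightarrow> 'o set \<Rightarrow> bool" where
  "tensor_t_structure T P U W \<longleftrightarrow> t_structure T U W \<and> (\<forall>A \<in> P. \<forall>B \<in> U. A \<boxtimes>\<^bsub>T\<^esub> B \<in> U)"

definition tensor_ideal :: "('o, 'm, 'z) tt_cat_scheme \<Rightarrow> 'o set \<Rightarrow> bool" where
  "tensor_ideal T S \<longleftrightarrow> thick T S \<and> (\<forall>A \<in> Obj T. \<forall>B \<in> S. A \<boxtimes>\<^bsub>T\<^esub> B \<in> S)"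

definition tensor_coideal :: "('o, 'm, 'z) tt_cat_scheme \<Rightarrow> 'o set \<Rightarrow> bool" where
  "tensor_coideal T S \<longleftrightarrow> thick T S \<and> (\<forall>A \<in> Obj T. \<forall>B \<in> S. ihom T A B \<in> S)"

end

theory Submission
  imports Defs
begin

text \<open>For a stable t-structure, \<open>U = \<^sup>\<bottom>V\<close> with \<open>V = U\<^sup>\<bottom>\<close>, so by adjunction \<open>A \<otimes> B \<in> U\<close> holds if and
  only if \<open>Hom(A, \<H>om(B, D)) = 0\<close> for all \<open>D \<in> V\<close>.  For \<open>B\<close> ranging over \<open>U\<close>, the objects
  \<open>\<H>om(B, D)\<close> are stable under both shifts, hence the \<open>A\<close> with \<open>A \<otimes> U \<subseteq> U\<close> form the left orthogonal
  of a shift-stable class, which is localizing; if they contain the generators \<open>T\<^sup>\<le>\<^sup>0\<close>, they are all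
  objects.  Reading the same vanishing condition with \<open>B \<in> U\<close> in the first argument and \<open>A\<close>
  arbitrary in the second shows that \<open>U\<close> is an ideal if and only if \<open>V\<close> is a coideal.\<close>

section \<open>Isomorphisms and functors\<close>

context category
begin

lemma arrs_obj:
  assumes "f \<in> arrs C A B"
  shows "A \<in> Obj C" "B \<in> Obj C" "f \<in> Arr C" "Dom C f = A" "Cod C f = B"
  using assms dom_obj cod_obj by (auto simp: arrs_def)

lemma isomorphic_iff:
  "isomorphic C A B \<longleftrightarrow>
     (\<exists>f \<in> arrs C A B. \<exists>g \<in> arrs C B A. g \<cdot> f = Idn C A \<and> f \<cdot> g = Idn C B)"
  unfolding isomorphic_def is_iso_def by (auto simp: arrs_def)

lemma isomorphic_sym: "isomorphic C A B \<Longrightarrow> isomorphic C B A"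
  unfolding isomorphic_iff by blast

lemma isomorphic_obj:
  assumes "isomorphic C A B"
  shows "A \<in> Obj C" "B \<in> Obj C"
  using assms arrs_obj unfolding isomorphic_def by blast+

lemma isomorphic_refl: "A \<in> Obj C \<Longrightarrow> isomorphic C A A"
  unfolding isomorphic_iff using idn_arr cmp_idn_left by blast

lemma isomorphic_trans:
  assumes "isomorphic C A B" "isomorphic C B D"
  shows "isomorphic C A D"
proof -
  from assms obtain f g h k where
    f: "f \<in> arrs C A B" and g: "g \<in> arrs C B A" and gf: "g \<cdot> f = Idn C A" and fg: "f \<cdot> g = Idn C B"
    and h: "h \<in> arrs C B D" and k: "k \<in> arrs C D B" and kh: "k \<cdot> h = Idn C B" and hk: "h \<cdot> k = Idn C D"
    unfolding isomorphic_iff by blast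
  have "(g \<cdot> k) \<cdot> (h \<cdot> f) = g \<cdot> ((k \<cdot> h) \<cdot> f)"
    using cmp_assoc[OF cmp_arr[OF f h] k g] cmp_assoc[OF f h k] by simp
  also have "\<dots> = Idn C A"
    using kh cmp_idn_left[OF f] gf by simp
  finally have 1: "(g \<cdot> k) \<cdot> (h \<cdot> f) = Idn C A" .
  have "(h \<cdot> f) \<cdot> (g \<cdot> k) = h \<cdot> ((f \<cdot> g) \<cdot> k)"
    using cmp_assoc[OF cmp_arr[OF k g] f h] cmp_assoc[OF k g f] by simp
  also have "\<dots> = Idn C D"
    using fg cmp_idn_left[OF k] hk by simp
  finally have 2: "(h \<cdot> f) \<cdot> (g \<cdot> k) = Idn C D" .
  show ?thesis
    unfolding isomorphic_iff using 1 2 cmp_arr[OF f h] cmp_arr[OF k g] by blast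
qed

text \<open>The two one-sided inverses agree:
  \<open>g = g \<cdot> (f \<cdot> h) = (g \<cdot> f) \<cdot> h = h\<close>. Exactness of a triangle
  yields them separately, which is why they are separate here.\<close>

lemma split_mono_split_epi_isomorphic:
  assumes f: "f \<in> arrs C A B" and g: "g \<in> arrs C B A" and h: "h \<in> arrs C B A"
    and gf: "g \<cdot> f = Idn C A" and fh: "f \<cdot> h = Idn C B"
  shows "isomorphic C A B"
proof -
  have "g = g \<cdot> (f \<cdot> h)"
    using fh cmp_idn_right[OF g] by simp
  also have "\<dots> = h"
    using cmp_assoc[OF h f g] gf cmp_idn_left[OF h] by simp
  finally show ?thesis
    unfolding isomorphic_iff using f g gf fh by blast
qed

lemma nat_iso_isomorphic:
  assumes "nat_iso D C F G \<eta>" "A \<in> Obj D"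
  shows "isomorphic C (ob F A) (ob G A)"
  using assms unfolding nat_iso_def isomorphic_def by blast

end

section \<open>Functors on Hom sets, and their effect on isomorphic objects\<close>

lemma functor_arrs:
  assumes "is_functor C D F" "f \<in> arrs C A B"
  shows "ar F f \<in> arrs D (ob F A) (ob F B)"
  using assms unfolding is_functor_def arrs_def by blast

lemma functor_cmp:
  assumes "is_functor C D F" "f \<in> arrs C A B" "g \<in> arrs C B E"
  shows "ar F (g \<cdot>\<^bsub>C\<^esub> f) = ar F g \<cdot>\<^bsub>D\<^esub> ar F f"
  using assms unfolding is_functor_def arrs_def by simp

lemma functor_obj: "is_functor C D F \<Longrightarrow> A \<in> Obj C \<Longrightarrow> ob F A \<in> Obj D"
  unfolding is_functor_def by blast

lemma functor_idn: "is_functor C D F \<Longrightarrow> A \<in> Obj C \<Longrightarrow> ar F (Idn C A) = Idn D (ob F A)"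
  unfolding is_functor_def by blast

lemma functor_isomorphic:
  assumes C: "category C" and D: "category D" and F: "is_functor C D F" and iso: "isomorphic C A B"
  shows "isomorphic D (ob F A) (ob F B)"
proof -
  from iso obtain f g where f: "f \<in> arrs C A B" and g: "g \<in> arrs C B A"
    and gf: "g \<cdot>\<^bsub>C\<^esub> f = Idn C A" and fg: "f \<cdot>\<^bsub>C\<^esub> g = Idn C B"
    unfolding category.isomorphic_iff[OF C] by blast
  have "A \<in> Obj C" "B \<in> Obj C"
    using category.arrs_obj[OF C f] by auto
  then have "ar F g \<cdot>\<^bsub>D\<^esub> ar F f = Idn D (ob F A)" "ar F f \<cdot>\<^bsub>D\<^esub> ar F g = Idn D (ob F B)"
    using functor_cmp[OF F f g] functor_cmp[OF F g f] gf fg functor_idn[OF F] by auto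
  then show ?thesis
    unfolding category.isomorphic_iff[OF D] using functor_arrs[OF F f] functor_arrs[OF F g] by blast
qed

section \<open>Zero arrows\<close>

context additive_category
begin

lemma zer_arr: "\<lbrakk>A \<in> Obj C; B \<in> Obj C\<rbrakk> \<Longrightarrow> Zer C A B \<in> arrs C A B"
  using group.is_monoid[OF comm_group.axioms(2)[OF hom_comm_group]] monoid.one_closed
  unfolding hom_group_def by fastforce

lemma neg_arr:
  assumes f: "f \<in> arrs C A B"
  shows "neg C f \<in> arrs C A B"
  using group.inv_closed[OF comm_group.axioms(2)[OF hom_comm_group[OF arrs_obj(1,2)[OF f]]], of f]
    f arrs_obj[OF f] by (simp add: neg_def hom_group_def)

lemma add_neg:
  assumes f: "f \<in> arrs C A B"
  shows "Add C f (neg C f) = Zer C A B"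
  using group.r_inv[OF comm_group.axioms(2)[OF hom_comm_group[OF arrs_obj(1,2)[OF f]]], of f]
    f arrs_obj[OF f] by (simp add: neg_def hom_group_def)

lemma add_zer:
  assumes f: "f \<in> arrs C A B"
  shows "Add C f (Zer C A B) = f"
  using monoid.r_one[OF group.is_monoid[OF comm_group.axioms(2)[OF hom_comm_group[OF arrs_obj(1,2)[OF f]]]], of f]
    f by (simp add: hom_group_def)

text \<open>Cancellation in the Hom group. Compositions with zero and images of zero under additive
  functors are recognised as zero because they equal their own double.\<close>

lemma zer_unique:
  assumes f: "f \<in> arrs C A B" and "Add C f f = f"
  shows "f = Zer C A B"
  using group.l_cancel_one[OF comm_group.axioms(2)[OF hom_comm_group[OF arrs_obj(1,2)[OF f]]], of f f]
    assms by (simp add: hom_group_def)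

lemma cmp_zer_left:
  assumes f: "f \<in> arrs C A B" and D: "D \<in> Obj C"
  shows "Zer C B D \<cdot> f = Zer C A D"
proof -
  have z: "Zer C B D \<in> arrs C B D"
    using arrs_obj(2)[OF f] D by (rule zer_arr)
  show ?thesis
    using zer_unique[OF cmp_arr[OF f z]] cmp_add_left[OF f z z] add_zer[OF z] by simp
qed

lemma cmp_zer_right:
  assumes f: "f \<in> arrs C B D" and A: "A \<in> Obj C"
  shows "f \<cdot> Zer C A B = Zer C A D"
proof -
  have z: "Zer C A B \<in> arrs C A B"
    using A arrs_obj(1)[OF f] by (rule zer_arr)
  show ?thesis
    using zer_unique[OF cmp_arr[OF z f]] cmp_add_right[OF z z f] add_zer[OF z] by simp
qed

lemma neg_unique:
  assumes f: "f \<in> arrs C A B" and g: "g \<in> arrs C A B" and "Add C f g = Zer C A B"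
  shows "g = neg C f"
proof -
  interpret H: comm_group "hom_group C A B"
    using hom_comm_group arrs_obj[OF f] by blast
  show ?thesis
    using H.inv_equality[of g f] H.m_comm[of f g] assms arrs_obj[OF f]
    by (simp add: neg_def hom_group_def)
qed

text \<open>Bilinearity gives \<open>h \<cdot> f + h \<cdot> neg f = h \<cdot> 0 = 0\<close>. The
  rules for \<open>neg\<close> serve to remove the signs that rotation of triangles
  introduces.\<close>

lemma cmp_neg_right:
  assumes f: "f \<in> arrs C A B" and h: "h \<in> arrs C B D"
  shows "h \<cdot> neg C f = neg C (h \<cdot> f)"
  using neg_unique[OF cmp_arr[OF f h] cmp_arr[OF neg_arr[OF f] h]]
    cmp_add_right[OF f neg_arr[OF f] h] add_neg[OF f] cmp_zer_right[OF h arrs_obj(1)[OF f]]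
  by simp

lemma cmp_neg_left:
  assumes f: "f \<in> arrs C A B" and h: "h \<in> arrs C B D"
  shows "neg C h \<cdot> f = neg C (h \<cdot> f)"
  using neg_unique[OF cmp_arr[OF f h] cmp_arr[OF f neg_arr[OF h]]]
    cmp_add_left[OF f h neg_arr[OF h]] add_neg[OF h] cmp_zer_left[OF f arrs_obj(2)[OF h]]
  by simp

lemma neg_neg:
  assumes f: "f \<in> arrs C A B"
  shows "neg C (neg C f) = f"
proof -
  interpret H: comm_group "hom_group C A B"
    using hom_comm_group arrs_obj[OF f] by blast
  show ?thesis
    using H.inv_inv[of f] f arrs_obj[OF f] arrs_obj[OF neg_arr[OF f]]
    by (simp add: neg_def hom_group_def)
qed

lemma hom_zeroI:
  assumes "A \<in> Obj C" "B \<in> Obj C" "\<And>f. f \<in> arrs C A B \<Longrightarrow> f = Zer C A B"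
  shows "arrs C A B = {Zer C A B}"
  using assms zer_arr by blast

text \<open>Every \<open>f\<close> equals \<open>(f \<cdot> p) \<cdot> i\<close>, and
  \<open>f \<cdot> p\<close> starts at \<open>X\<close>, so it vanishes. Retracts cover isomorphic
  objects and direct summands at once.\<close>

lemma hom_zero_dom_retract:
  assumes i: "i \<in> arrs C A X" and p: "p \<in> arrs C X A" and pi: "p \<cdot> i = Idn C A"
    and X: "arrs C X D = {Zer C X D}" and D: "D \<in> Obj C"
  shows "arrs C A D = {Zer C A D}"
proof (rule hom_zeroI)
  fix f assume f: "f \<in> arrs C A D"
  have "f \<cdot> p = Zer C X D"
    using cmp_arr[OF p f] X by blast
  then have "f \<cdot> (p \<cdot> i) = Zer C A D"
    using cmp_assoc[OF i p f] cmp_zer_left[OF i D] by simp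
  then show "f = Zer C A D"
    using pi cmp_idn_right[OF f] by simp
qed (use arrs_obj[OF i] D in auto)

lemma hom_zero_cod_retract:
  assumes i: "i \<in> arrs C A X" and p: "p \<in> arrs C X A" and pi: "p \<cdot> i = Idn C A"
    and X: "arrs C E X = {Zer C E X}" and E: "E \<in> Obj C"
  shows "arrs C E A = {Zer C E A}"
proof (rule hom_zeroI)
  fix f assume f: "f \<in> arrs C E A"
  have "i \<cdot> f = Zer C E X"
    using cmp_arr[OF f i] X by blast
  then have "(p \<cdot> i) \<cdot> f = Zer C E A"
    using cmp_assoc[OF f i p] cmp_zer_right[OF p E] by simp
  then show "f = Zer C E A"
    using pi cmp_idn_left[OF f] by simp
qed (use arrs_obj[OF i] E in auto)

lemma hom_zero_dom_iso:
  assumes "isomorphic C A X" "arrs C X D = {Zer C X D}" "D \<in> Obj C"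
  shows "arrs C A D = {Zer C A D}"
  using assms hom_zero_dom_retract unfolding isomorphic_iff by blast

lemma hom_zero_cod_iso:
  assumes "isomorphic C A X" "arrs C E X = {Zer C E X}" "E \<in> Obj C"
  shows "arrs C E A = {Zer C E A}"
  using assms hom_zero_cod_retract unfolding isomorphic_iff by blast

lemma binary_coproduct_retract:
  assumes "is_binary_coproduct C A B X \<iota>"
  obtains p where "\<iota> True \<in> arrs C A X" "p \<in> arrs C X A" "p \<cdot> \<iota> True = Idn C A"
proof -
  have "\<forall>b. (if b then A else B) \<in> Obj C \<and> \<iota> b \<in> arrs C (if b then A else B) X"
    using assms unfolding is_coproduct_def by blast
  from this[rule_format, of True] this[rule_format, of False]
  have A: "A \<in> Obj C" and B: "B \<in> Obj C" and i: "\<iota> True \<in> arrs C A X"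
    by auto
  \<comment> \<open>The cocone of the projection onto the first summand: the identity on
    \<open>A\<close> and zero on \<open>B\<close>.\<close>
  let ?f = "\<lambda>b. if b then Idn C A else Zer C B A"
  have f: "\<forall>b\<in>UNIV. ?f b \<in> arrs C (if b then A else B) A"
    using idn_arr[OF A] zer_arr[OF B A] by simp
  have "\<forall>f. (\<forall>b\<in>UNIV. f b \<in> arrs C (if b then A else B) A) \<longrightarrow>
      (\<exists>!h. h \<in> arrs C X A \<and> (\<forall>b\<in>UNIV. h \<cdot> \<iota> b = f b))"
    using assms A unfolding is_coproduct_def by blast
  from mp[OF spec[OF this, of ?f] f]
  obtain p where p: "p \<in> arrs C X A" "\<forall>b\<in>UNIV. p \<cdot> \<iota> b = ?f b"
    by blast
  show thesis
    using that[OF i p(1)] bspec[OF p(2), of True] by simp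
qed

lemma zero_object_hom:
  assumes "zero_object C Z" "A \<in> Obj C"
  shows "arrs C Z A = {Zer C Z A}" "arrs C A Z = {Zer C A Z}"
  using assms zer_arr unfolding zero_object_def by blast+

text \<open>Composing with a vanishing identity kills every arrow into or out of \<open>Z\<close>.
  This form transfers along additive functors, unlike the universal property.\<close>

lemma zero_object_iff_idn:
  assumes Z: "Z \<in> Obj C"
  shows "zero_object C Z \<longleftrightarrow> Idn C Z = Zer C Z Z"
proof
  assume "zero_object C Z"
  then show "Idn C Z = Zer C Z Z"
    using zero_object_hom(1) Z idn_arr by blast
next
  assume id: "Idn C Z = Zer C Z Z"
  have "f = Zer C Z A" if "f \<in> arrs C Z A" for f A
    using cmp_idn_right[OF that] cmp_zer_right[OF that Z] id by simp
  moreover have "f = Zer C A Z" if "f \<in> arrs C A Z" for f A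
    using cmp_idn_left[OF that] cmp_zer_left[OF that Z] id by simp
  ultimately show "zero_object C Z"
    unfolding zero_object_def using zer_arr Z by metis
qed

end

lemma functor_zer:
  assumes C: "additive_category C" and D: "additive_category D"
    and F: "is_functor C D F" "preserves_sums C D F" and AB: "A \<in> Obj C" "B \<in> Obj C"
  shows "ar F (Zer C A B) = Zer D (ob F A) (ob F B)"
proof -
  interpret C: additive_category C by fact
  interpret D: additive_category D by fact
  have z: "Zer C A B \<in> arrs C A B"
    using AB by (rule C.zer_arr)
  then have "Add D (ar F (Zer C A B)) (ar F (Zer C A B)) = ar F (Zer C A B)"
    using F(2) AB C.add_zer[OF z] unfolding preserves_sums_def by metis
  then show ?thesis
    by (rule D.zer_unique[OF functor_arrs[OF F(1) z]])
qed

section \<open>The shift functor\<close>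

context triangulated_category
begin

abbreviation shift where "shift \<equiv> ob (Shift T)"
abbreviation unshift where "unshift \<equiv> ob (Unshift T)"

text \<open>Naturality reads \<open>\<eta> B \<cdot> f = ar F f \<cdot> \<eta> A\<close>, so
  \<open>ar F f\<close> determines \<open>f\<close> once \<open>\<eta> B\<close> is
  cancelled.\<close>

lemma nat_iso_id_faithful:
  assumes n: "nat_iso T T id_fctr F \<eta>" and f: "f \<in> arrs T A B" and g: "g \<in> arrs T A B"
    and eq: "ar F f = ar F g"
  shows "f = g"
proof -
  have \<eta>: "\<eta> B \<in> arrs T B (ob F B)" "is_iso T (\<eta> B)"
    using n arrs_obj[OF f] unfolding nat_iso_def id_fctr_def by auto
  then obtain k where k: "k \<in> arrs T (ob F B) B" "k \<cdot> \<eta> B = Idn T B"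
    unfolding is_iso_def using arrs_obj[OF \<eta>(1)] by auto
  have "\<eta> B \<cdot> h = ar F h \<cdot> \<eta> A" if h: "h \<in> arrs T A B" for h
    using n arrs_obj[OF h] unfolding nat_iso_def id_fctr_def by auto
  then have "\<eta> B \<cdot> f = \<eta> B \<cdot> g"
    using f g eq by metis
  then show "f = g"
    using cmp_assoc[OF f \<eta>(1) k(1)] cmp_assoc[OF g \<eta>(1) k(1)] k(2) cmp_idn_left[OF f] cmp_idn_left[OF g]
    by simp
qed

lemma shift_faithful:
  assumes "f \<in> arrs T A B" "g \<in> arrs T A B" "ar (Shift T) f = ar (Shift T) g"
  shows "f = g"
proof -
  obtain \<eta> where "nat_iso T T id_fctr (comp_fctr (Unshift T) (Shift T)) \<eta>"
    using unshift_shift by blast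
  then show ?thesis
    using nat_iso_id_faithful assms by (simp add: comp_fctr_def)
qed

text \<open>Here the natural isomorphism ends at the identity functor, so
  \<open>\<epsilon> A\<close> is cancelled on the right instead. Fullness of the shift depends on
  this.\<close>

lemma unshift_faithful:
  assumes f: "f \<in> arrs T A B" and g: "g \<in> arrs T A B" and eq: "ar (Unshift T) f = ar (Unshift T) g"
  shows "f = g"
proof -
  obtain \<epsilon> where e: "nat_iso T T (comp_fctr (Shift T) (Unshift T)) id_fctr \<epsilon>"
    using shift_unshift by blast
  have \<epsilon>: "\<epsilon> A \<in> arrs T (shift (unshift A)) A" "is_iso T (\<epsilon> A)"
    using e arrs_obj[OF f] unfolding nat_iso_def id_fctr_def comp_fctr_def by auto
  then obtain k where k: "k \<in> arrs T A (shift (unshift A))" "\<epsilon> A \<cdot> k = Idn T A"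
    unfolding is_iso_def using arrs_obj[OF \<epsilon>(1)] by auto
  have "\<epsilon> B \<cdot> ar (Shift T) (ar (Unshift T) h) = h \<cdot> \<epsilon> A" if h: "h \<in> arrs T A B" for h
    using e arrs_obj[OF h] unfolding nat_iso_def id_fctr_def comp_fctr_def by auto
  then have fg: "f \<cdot> \<epsilon> A = g \<cdot> \<epsilon> A"
    using f g eq by metis
  have "f = (f \<cdot> \<epsilon> A) \<cdot> k"
    using cmp_assoc[OF k(1) \<epsilon>(1) f] k(2) cmp_idn_right[OF f] by simp
  also have "\<dots> = g"
    unfolding fg using cmp_assoc[OF k(1) \<epsilon>(1) g] k(2) cmp_idn_right[OF g] by simp
  finally show "f = g" .
qed

lemma shift_full:
  assumes A: "A \<in> Obj T" and B: "B \<in> Obj T" and h: "h \<in> arrs T (shift A) (shift B)"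
  obtains f where "f \<in> arrs T A B" "ar (Shift T) f = h"
proof -
  obtain \<eta> where n: "nat_iso T T id_fctr (comp_fctr (Unshift T) (Shift T)) \<eta>"
    using unshift_shift by blast
  have \<eta>: "\<eta> X \<in> arrs T X (unshift (shift X))" "is_iso T (\<eta> X)" if "X \<in> Obj T" for X
    using n that unfolding nat_iso_def id_fctr_def comp_fctr_def by auto
  obtain k where k: "k \<in> arrs T (unshift (shift A)) A" "\<eta> A \<cdot> k = Idn T (unshift (shift A))"
    using \<eta>[OF A] unfolding is_iso_def using arrs_obj[OF \<eta>(1)[OF A]] by auto
  obtain l where l: "l \<in> arrs T (unshift (shift B)) B" "\<eta> B \<cdot> l = Idn T (unshift (shift B))"
    using \<eta>[OF B] unfolding is_iso_def using arrs_obj[OF \<eta>(1)[OF B]] by auto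
  let ?h = "ar (Unshift T) h"
  have uh: "?h \<in> arrs T (unshift (shift A)) (unshift (shift B))"
    by (rule functor_arrs[OF unshift_functor h])
  \<comment> \<open>Naturality of \<open>\<eta>\<close> forces this choice: a preimage of
    \<open>h\<close> must satisfy \<open>\<eta> B \<cdot> f = ?h \<cdot> \<eta> A\<close>, and
    \<open>l\<close> undoes \<open>\<eta> B\<close>.\<close>
  define f where "f = l \<cdot> (?h \<cdot> \<eta> A)"
  have hA: "?h \<cdot> \<eta> A \<in> arrs T A (unshift (shift B))"
    by (rule cmp_arr[OF \<eta>(1)[OF A] uh])
  have f: "f \<in> arrs T A B"
    unfolding f_def by (rule cmp_arr[OF hA l(1)])
  let ?f = "ar (Unshift T) (ar (Shift T) f)"
  have sf: "ar (Shift T) f \<in> arrs T (shift A) (shift B)"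
    by (rule functor_arrs[OF shift_functor f])
  have usf: "?f \<in> arrs T (unshift (shift A)) (unshift (shift B))"
    by (rule functor_arrs[OF unshift_functor sf])
  have "?f \<cdot> \<eta> A = \<eta> B \<cdot> f"
    using n arrs_obj[OF f] unfolding nat_iso_def id_fctr_def comp_fctr_def by auto
  also have "\<dots> = ?h \<cdot> \<eta> A"
    unfolding f_def using cmp_assoc[OF hA l(1) \<eta>(1)[OF B]] l(2) cmp_idn_left[OF hA] by simp
  finally have "?f \<cdot> \<eta> A = ?h \<cdot> \<eta> A" .
  then have "?f = ?h"
    using cmp_assoc[OF k(1) \<eta>(1)[OF A] uh] cmp_assoc[OF k(1) \<eta>(1)[OF A] usf] k(2)
      cmp_idn_right[OF uh] cmp_idn_right[OF usf] by simp
  then have "ar (Shift T) f = h"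
    using unshift_faithful[OF sf h] by blast
  with f that show thesis by blast
qed

section \<open>Objects, isomorphisms and vanishing of Hom under the shift\<close>

lemma shift_obj: "A \<in> Obj T \<Longrightarrow> shift A \<in> Obj T"
  using functor_obj[OF shift_functor] .

lemma unshift_obj: "A \<in> Obj T \<Longrightarrow> unshift A \<in> Obj T"
  using functor_obj[OF unshift_functor] .

lemma isomorphic_unshift_shift: "A \<in> Obj T \<Longrightarrow> isomorphic T A (unshift (shift A))"
  using unshift_shift nat_iso_isomorphic by (force simp: id_fctr_def comp_fctr_def)

lemma isomorphic_shift_unshift: "A \<in> Obj T \<Longrightarrow> isomorphic T (shift (unshift A)) A"
  using shift_unshift nat_iso_isomorphic by (force simp: id_fctr_def comp_fctr_def)

lemma shift_zer:
  "\<lbrakk>A \<in> Obj T; B \<in> Obj T\<rbrakk> \<Longrightarrow> ar (Shift T) (Zer T A B) = Zer T (shift A) (shift B)"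
  using functor_zer[OF additive_category_axioms additive_category_axioms shift_functor shift_additive] .

lemma hom_zero_shift:
  assumes A: "A \<in> Obj T" and B: "B \<in> Obj T"
  shows "arrs T (shift A) (shift B) = {Zer T (shift A) (shift B)} \<longleftrightarrow> arrs T A B = {Zer T A B}"
proof
  assume h: "arrs T (shift A) (shift B) = {Zer T (shift A) (shift B)}"
  show "arrs T A B = {Zer T A B}"
  proof (rule hom_zeroI[OF A B])
    fix f assume f: "f \<in> arrs T A B"
    then have "ar (Shift T) f = ar (Shift T) (Zer T A B)"
      using functor_arrs[OF shift_functor f] h shift_zer[OF A B] by auto
    then show "f = Zer T A B"
      using shift_faithful[OF f zer_arr[OF A B]] by blast
  qed
next
  assume h: "arrs T A B = {Zer T A B}"
  show "arrs T (shift A) (shift B) = {Zer T (shift A) (shift B)}"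
  proof (rule hom_zeroI[OF shift_obj[OF A] shift_obj[OF B]])
    fix f assume "f \<in> arrs T (shift A) (shift B)"
    then obtain g where "g \<in> arrs T A B" "ar (Shift T) g = f"
      using shift_full A B by blast
    then show "f = Zer T (shift A) (shift B)"
      using h shift_zer[OF A B] by auto
  qed
qed

lemma zero_object_shift:
  assumes "zero_object T Z"
  shows "zero_object T (shift Z)"
proof -
  have Z: "Z \<in> Obj T"
    using assms unfolding zero_object_def by blast
  then have "Idn T Z = Zer T Z Z"
    using zero_object_iff_idn assms by blast
  then have "Idn T (shift Z) = Zer T (shift Z) (shift Z)"
    using functor_idn[OF shift_functor Z] shift_zer[OF Z Z] by simp
  then show ?thesis
    using zero_object_iff_idn[OF shift_obj[OF Z]] by blast
qed

section \<open>Exactness of distinguished triangles\<close>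

lemma dist_arrs:
  assumes "(u, v, w) \<in> Dist T"
  shows "u \<in> arrs T (Dom T u) (Dom T v)" "v \<in> arrs T (Dom T v) (Dom T w)"
    "w \<in> arrs T (Dom T w) (shift (Dom T u))" "Cod T u = Dom T v" "Cod T v = Dom T w"
  using dist_triangle[OF assms] unfolding triangle_def arrs_def by auto

lemma dist_rotate:
  "(u, v, w) \<in> Dist T \<Longrightarrow> (v, w, neg T (ar (Shift T) u)) \<in> Dist T"
  using TR2 dist_triangle by blast

text \<open>The triangle \<open>0 \<rightarrow> D \<rightarrow> D \<rightarrow> 0[1]\<close> is the
  inverse rotation of the one that \<open>TR1_idn\<close> gives for \<open>D\<close> and the zero
  object \<open>shift Z\<close>. The sign disappears because there is only one arrow out of
  \<open>shift Z\<close> to a given object.\<close>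

lemma dist_zero_idn:
  assumes D: "D \<in> Obj T" and Z: "zero_object T Z"
  shows "(Zer T Z D, Idn T D, Zer T D (shift Z)) \<in> Dist T"
proof -
  have ZO: "Z \<in> Obj T" using Z unfolding zero_object_def by blast
  let ?u = "Zer T Z D"
  have u: "?u \<in> arrs T Z D" by (rule zer_arr[OF ZO D])
  have w: "Zer T D (shift Z) \<in> arrs T D (shift Z)" by (rule zer_arr[OF D shift_obj[OF ZO]])
  have tr: "triangle T ?u (Idn T D) (Zer T D (shift Z))"
    unfolding triangle_def using u w idn_arr[OF D] by (auto simp: arrs_def)
  have "neg T (ar (Shift T) ?u) = Zer T (shift Z) (shift D)"
    using zero_object_hom(1)[OF zero_object_shift[OF Z] shift_obj[OF D]]
      neg_arr[OF functor_arrs[OF shift_functor u]] by blast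
  then show ?thesis
    using TR2[OF tr] TR1_idn[OF D zero_object_shift[OF Z]] by simp
qed

text \<open>Exactness of \<open>Hom(-, D)\<close> at the third object. Since
  \<open>f \<cdot> v = 0\<close>, the pair \<open>(0, f)\<close> begins a morphism from the rotated
  triangle to \<open>0 \<rightarrow> D \<rightarrow> D \<rightarrow> 0[1]\<close>; the third
  component supplied by \<open>TR3\<close> is \<open>g\<close>.\<close>

lemma dist_exact_contra:
  assumes t: "(u, v, w) \<in> Dist T" and f: "f \<in> arrs T (Dom T w) D"
    and fv: "f \<cdot> v = Zer T (Dom T v) D"
  obtains g where "g \<in> arrs T (shift (Dom T u)) D" "f = g \<cdot> w"
proof -
  note a = dist_arrs[OF t]
  have D: "D \<in> Obj T" and Y: "Dom T v \<in> Obj T"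
    using arrs_obj[OF f] arrs_obj[OF a(2)] by auto
  obtain Z where Z: "zero_object T Z" using ex_zero_object by blast
  then have ZO: "Z \<in> Obj T" unfolding zero_object_def by blast
  have z: "Zer T (Dom T v) Z \<in> arrs T (Dom T v) Z" by (rule zer_arr[OF Y ZO])
  have zd: "Zer T Z D \<in> arrs T Z D" by (rule zer_arr[OF ZO D])
  have doms: "Dom T (Zer T Z D) = Z" "Dom T (Idn T D) = D" "Dom T (Zer T D (shift Z)) = D"
    "Dom T (neg T (ar (Shift T) u)) = shift (Dom T u)"
    using arrs_obj(4)[OF zd] arrs_obj(4)[OF idn_arr[OF D]] arrs_obj(4)[OF zer_arr[OF D shift_obj[OF ZO]]]
      arrs_obj(4)[OF neg_arr[OF functor_arrs[OF shift_functor a(1)]]] by auto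
  have "f \<cdot> v = Zer T Z D \<cdot> Zer T (Dom T v) Z"
    using fv cmp_zer_left[OF z D] by simp
  then obtain c where
    "triangle_morphism T (v, w, neg T (ar (Shift T) u)) (Zer T Z D, Idn T D, Zer T D (shift Z))
       (Zer T (Dom T v) Z, f, c)"
    using TR3[OF dist_rotate[OF t] dist_zero_idn[OF D Z], of "Zer T (Dom T v) Z" f] z f doms by auto
  then have "c \<in> arrs T (shift (Dom T u)) D" "c \<cdot> w = f"
    unfolding triangle_morphism_def using doms cmp_idn_left[OF f] by auto
  with that show thesis by blast
qed

text \<open>Exactness of \<open>Hom(A, -)\<close> at the third object. \<open>TR3\<close> fills in
  third components only, so both triangles are rotated until the desired factor sits there as an
  arrow \<open>shift A \<rightarrow> shift (Dom T v)\<close>. Full faithfulness of the shift then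
  brings it back to \<open>A\<close>.\<close>

lemma dist_exact_co:
  assumes t: "(u, v, w) \<in> Dist T" and f: "f \<in> arrs T A (Dom T w)"
    and wf: "w \<cdot> f = Zer T A (shift (Dom T u))"
  obtains g where "g \<in> arrs T A (Dom T v)" "f = v \<cdot> g"
proof -
  note a = dist_arrs[OF t]
  have A: "A \<in> Obj T" and X: "Dom T u \<in> Obj T" and Y: "Dom T v \<in> Obj T"
    using arrs_obj[OF f] arrs_obj[OF a(1)] by auto
  have XS: "shift (Dom T u) \<in> Obj T" and AS: "shift A \<in> Obj T"
    using X A by (auto intro: shift_obj)
  obtain Z where Z: "zero_object T Z" using ex_zero_object by blast
  then have ZO: "Z \<in> Obj T" unfolding zero_object_def by blast
  let ?S = "ar (Shift T)"
  have az: "Zer T A Z \<in> arrs T A Z" and za: "Zer T Z (shift A) \<in> arrs T Z (shift A)"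
    and zx: "Zer T Z (shift (Dom T u)) \<in> arrs T Z (shift (Dom T u))"
    using A ZO XS AS by (auto intro: zer_arr)
  have su: "?S u \<in> arrs T (shift (Dom T u)) (shift (Dom T v))"
    and sv: "?S v \<in> arrs T (shift (Dom T v)) (shift (Dom T w))"
    and sf: "?S f \<in> arrs T (shift A) (shift (Dom T w))"
    and sid: "?S (Idn T A) \<in> arrs T (shift A) (shift A)"
    using functor_arrs[OF shift_functor] a(1,2) f idn_arr[OF A] by auto
  have doms: "Dom T (Zer T A Z) = A" "Dom T (Zer T Z (shift A)) = Z"
    "Dom T (neg T (?S (Idn T A))) = shift A" "Dom T (neg T (?S u)) = shift (Dom T u)"
    "Dom T (neg T (?S v)) = shift (Dom T v)"
    using arrs_obj(4) az za neg_arr[OF sid] neg_arr[OF su] neg_arr[OF sv] by auto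
  have t1: "(Zer T A Z, Zer T Z (shift A), neg T (?S (Idn T A))) \<in> Dist T"
    by (rule dist_rotate[OF TR1_idn[OF A Z]])
  have t2: "(w, neg T (?S u), neg T (?S v)) \<in> Dist T"
    by (rule dist_rotate[OF dist_rotate[OF t]])
  have "Zer T Z (shift (Dom T u)) \<cdot> Zer T A Z = w \<cdot> f"
    using wf cmp_zer_left[OF az XS] by simp
  then obtain c where
    "triangle_morphism T (Zer T A Z, Zer T Z (shift A), neg T (?S (Idn T A)))
       (w, neg T (?S u), neg T (?S v)) (f, Zer T Z (shift (Dom T u)), c)"
    using TR3[OF t1 t2, of f "Zer T Z (shift (Dom T u))"] f zx doms by auto
  then have c: "c \<in> arrs T (shift A) (shift (Dom T v))"
    and eq: "?S f \<cdot> neg T (?S (Idn T A)) = neg T (?S v) \<cdot> c"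
    unfolding triangle_morphism_def using doms by auto
  obtain g where g: "g \<in> arrs T A (Dom T v)" "?S g = c"
    using shift_full[OF A Y c] by blast
  \<comment> \<open>Each rotated triangle contributes one sign, one on either side of
    \<open>eq\<close>, so the signs cancel.\<close>
  have "neg T (?S f) = neg T (?S v \<cdot> ?S g)"
    using eq cmp_neg_right[OF sid sf] cmp_neg_left[OF c sv] g(2)
      functor_cmp[OF shift_functor idn_arr[OF A] f] cmp_idn_right[OF f] by simp
  moreover have "?S v \<cdot> ?S g = ?S (v \<cdot> g)"
    using functor_cmp[OF shift_functor g(1) a(2)] by simp
  ultimately have "neg T (?S f) = neg T (?S (v \<cdot> g))" by simp
  then have "?S f = ?S (v \<cdot> g)"
    using neg_neg[OF sf] neg_neg[OF functor_arrs[OF shift_functor cmp_arr[OF g(1) a(2)]]] by metis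
  then have "f = v \<cdot> g"
    using shift_faithful[OF f cmp_arr[OF g(1) a(2)]] by blast
  with g(1) that show thesis by blast
qed

section \<open>Orthogonal subcategories\<close>

definition left_orth :: "'o set \<Rightarrow> 'o set" where
  "left_orth S = {A \<in> Obj T. \<forall>B \<in> S. arrs T A B = {Zer T A B}}"

text \<open>The class \<open>S\<close> is shift-stable only up to isomorphism, since internal homs
  commute with shifts only in that sense. A shift of \<open>A\<close> is traded for the opposite
  shift of \<open>B\<close>: \<open>down\<close> gives closure under \<open>shift\<close>,
  \<open>up\<close> under \<open>unshift\<close>. Cones follow from exactness of
  \<open>Hom(-, B)\<close>, and coproducts from their universal property.\<close>

lemma left_orth_localizing:
  assumes S: "S \<subseteq> Obj T"
    and down: "\<And>X. X \<in> S \<Longrightarrow> \<exists>Y \<in> S. isomorphic T X (shift Y)"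
    and up: "\<And>X. X \<in> S \<Longrightarrow> \<exists>Y \<in> S. isomorphic T (shift X) Y"
  shows "localizing \<K> T (left_orth S)"
proof -
  let ?L = "left_orth S"
  have shift: "shift A \<in> ?L" if "A \<in> ?L" for A
  proof -
    have A: "A \<in> Obj T" using that unfolding left_orth_def by blast
    have "arrs T (shift A) B = {Zer T (shift A) B}" if B: "B \<in> S" for B
    proof -
      obtain Y where Y: "Y \<in> S" "isomorphic T B (shift Y)" using down B by blast
      then have "arrs T (shift A) (shift Y) = {Zer T (shift A) (shift Y)}"
        using hom_zero_shift[OF A, of Y] \<open>A \<in> ?L\<close> S unfolding left_orth_def by blast
      then show ?thesis
        using hom_zero_cod_iso[OF Y(2)] shift_obj[OF A] by blast
    qed
    then show ?thesis unfolding left_orth_def using shift_obj[OF A] by blast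
  qed
  have unshift: "unshift A \<in> ?L" if "A \<in> ?L" for A
  proof -
    have A: "A \<in> Obj T" using that unfolding left_orth_def by blast
    have "arrs T (unshift A) B = {Zer T (unshift A) B}" if B: "B \<in> S" for B
    proof -
      have BO: "B \<in> Obj T" using B S by blast
      obtain Y where Y: "Y \<in> S" "isomorphic T (shift B) Y" using up B by blast
      then have "arrs T A (shift B) = {Zer T A (shift B)}"
        using hom_zero_cod_iso[OF Y(2) _ A] \<open>A \<in> ?L\<close> unfolding left_orth_def by blast
      then have "arrs T (shift (unshift A)) (shift B) = {Zer T (shift (unshift A)) (shift B)}"
        using hom_zero_dom_iso[OF isomorphic_shift_unshift[OF A]] shift_obj[OF BO] by blast
      then show ?thesis
        using hom_zero_shift[OF unshift_obj[OF A] BO] by blast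
    qed
    then show ?thesis unfolding left_orth_def using unshift_obj[OF A] by blast
  qed
  have replete: "replete T ?L"
    unfolding replete_def left_orth_def
    using hom_zero_dom_iso[OF isomorphic_sym] S by blast
  have zero: "\<exists>Z \<in> ?L. zero_object T Z"
  proof -
    obtain Z where Z: "zero_object T Z" using ex_zero_object by blast
    then have "Z \<in> ?L"
      unfolding left_orth_def using zero_object_hom(1)[OF Z] S by (auto simp: zero_object_def)
    with Z show ?thesis by blast
  qed
  have cone: "Cod T v \<in> ?L" if t: "(u, v, w) \<in> Dist T" and X: "Dom T u \<in> ?L" and Y: "Cod T u \<in> ?L" for u v w
  proof -
    note a = dist_arrs[OF t]
    have "arrs T (Dom T w) B = {Zer T (Dom T w) B}" if B: "B \<in> S" for B
    proof (rule hom_zeroI)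
      fix f assume f: "f \<in> arrs T (Dom T w) B"
      have "f \<cdot> v = Zer T (Dom T v) B"
        using cmp_arr[OF a(2) f] Y B a(4) unfolding left_orth_def by auto
      then obtain g where g: "g \<in> arrs T (shift (Dom T u)) B" "f = g \<cdot> w"
        using dist_exact_contra[OF t f] by blast
      then have "g = Zer T (shift (Dom T u)) B"
        using shift[OF X] B unfolding left_orth_def by blast
      then show "f = Zer T (Dom T w) B"
        using g(2) cmp_zer_left[OF a(3)] B S by blast
    qed (use arrs_obj[OF a(3)] B S in auto)
    then show ?thesis
      unfolding left_orth_def using a(5) arrs_obj(1)[OF a(3)] by auto
  qed
  have summand: "summand_closed T ?L"
    unfolding summand_closed_def
  proof (intro ballI allI impI)
    fix X A B \<iota> assume X: "X \<in> ?L" and cp: "is_binary_coproduct T A B X \<iota>"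
    obtain p where p: "\<iota> True \<in> arrs T A X" "p \<in> arrs T X A" "p \<cdot> \<iota> True = Idn T A"
      using binary_coproduct_retract[OF cp] by blast
    then show "A \<in> ?L"
      using hom_zero_dom_retract[OF p] X S arrs_obj(1)[OF p(1)] unfolding left_orth_def by blast
  qed
  have coproduct: "coproduct_closed \<K> T ?L"
    unfolding coproduct_closed_def
  proof (intro ballI allI impI)
    fix I X Y \<iota> assume "(\<forall>i \<in> I. X i \<in> ?L) \<and> is_coproduct T I X Y \<iota>"
    then have X: "\<And>i. i \<in> I \<Longrightarrow> X i \<in> ?L" and cp: "is_coproduct T I X Y \<iota>" by auto
    have Y: "Y \<in> Obj T" and \<iota>: "\<And>i. i \<in> I \<Longrightarrow> \<iota> i \<in> arrs T (X i) Y"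
      using cp unfolding is_coproduct_def by auto
    have "arrs T Y B = {Zer T Y B}" if B: "B \<in> S" for B
    proof (rule hom_zeroI)
      show BO: "B \<in> Obj T" using B S by blast
      fix f assume f: "f \<in> arrs T Y B"
      have "\<forall>i\<in>I. Zer T (X i) B \<in> arrs T (X i) B"
        using X BO zer_arr unfolding left_orth_def by blast
      \<comment> \<open>Both \<open>f\<close> and the zero arrow induce the zero cocone, so
        uniqueness identifies them.\<close>
      then have "\<exists>!h. h \<in> arrs T Y B \<and> (\<forall>i \<in> I. h \<cdot> \<iota> i = Zer T (X i) B)"
        using cp BO unfolding is_coproduct_def by (elim conjE) (erule ballE[of _ _ B], auto)
      moreover have "\<forall>i \<in> I. f \<cdot> \<iota> i = Zer T (X i) B"
        using cmp_arr[OF \<iota> f] X B unfolding left_orth_def by blast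
      moreover have "\<forall>i \<in> I. Zer T Y B \<cdot> \<iota> i = Zer T (X i) B"
        using cmp_zer_left[OF \<iota> BO] by blast
      ultimately show "f = Zer T Y B"
        using f zer_arr[OF Y BO] by blast
    qed (rule Y)
    then show "Y \<in> ?L" unfolding left_orth_def using Y by blast
  qed
  show ?thesis
    unfolding localizing_def triangulated_sub_def
    using replete zero shift unshift cone summand coproduct by fast
qed

text \<open>\<open>Hom(A, B[1])\<close> vanishes exactly when \<open>Hom(A[-1], B)\<close> does, so
  closure of \<open>S\<close> under \<open>unshift\<close> makes the orthogonal closed under
  \<open>shift\<close>.\<close>

lemma right_orth_shift:
  assumes S: "S \<subseteq> Obj T" and un: "\<And>A. A \<in> S \<Longrightarrow> unshift A \<in> S" and B: "B \<in> right_orth T S"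
  shows "shift B \<in> right_orth T S"
proof -
  have BO: "B \<in> Obj T" using B unfolding right_orth_def by blast
  have "arrs T A (shift B) = {Zer T A (shift B)}" if A: "A \<in> S" for A
  proof -
    have AO: "A \<in> Obj T" using A S by blast
    have "arrs T (shift (unshift A)) (shift B) = {Zer T (shift (unshift A)) (shift B)}"
      using hom_zero_shift[OF unshift_obj[OF AO] BO] un[OF A] B unfolding right_orth_def by blast
    then show ?thesis
      using hom_zero_dom_iso[OF isomorphic_sym[OF isomorphic_shift_unshift[OF AO]]] shift_obj[OF BO] by blast
  qed
  then show ?thesis unfolding right_orth_def using shift_obj[OF BO] by blast
qed

lemma right_orth_unshift:
  assumes S: "S \<subseteq> Obj T" and sh: "\<And>A. A \<in> S \<Longrightarrow> shift A \<in> S" and B: "B \<in> right_orth T S"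
  shows "unshift B \<in> right_orth T S"
proof -
  have BO: "B \<in> Obj T" using B unfolding right_orth_def by blast
  have "arrs T A (unshift B) = {Zer T A (unshift B)}" if A: "A \<in> S" for A
  proof -
    have AO: "A \<in> Obj T" using A S by blast
    have "arrs T (shift A) (shift (unshift B)) = {Zer T (shift A) (shift (unshift B))}"
      using hom_zero_cod_iso[OF isomorphic_shift_unshift[OF BO] _ shift_obj[OF AO]] sh[OF A] B
      unfolding right_orth_def by blast
    then show ?thesis
      using hom_zero_shift[OF AO unshift_obj[OF BO]] by blast
  qed
  then show ?thesis unfolding right_orth_def using unshift_obj[OF BO] by blast
qed

text \<open>For cones, \<open>w \<cdot> f\<close> lands in a shift of the first object and vanishes,
  so \<open>f\<close> factors through the second object, where arrows from \<open>A\<close> vanish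
  as well. Summands are retracts.\<close>

lemma right_orth_thick:
  assumes S: "S \<subseteq> Obj T" and sh: "\<And>A. A \<in> S \<Longrightarrow> shift A \<in> S"
    and un: "\<And>A. A \<in> S \<Longrightarrow> unshift A \<in> S"
  shows "thick T (right_orth T S)"
proof -
  let ?R = "right_orth T S"
  have shift: "shift B \<in> ?R" if "B \<in> ?R" for B
    using right_orth_shift[OF S un that] .
  have unshift: "unshift B \<in> ?R" if "B \<in> ?R" for B
    using right_orth_unshift[OF S sh that] .
  have replete: "replete T ?R"
    unfolding replete_def right_orth_def
    using hom_zero_cod_iso[OF isomorphic_sym] S by blast
  have zero: "\<exists>Z \<in> ?R. zero_object T Z"
  proof -
    obtain Z where Z: "zero_object T Z" using ex_zero_object by blast
    then have "Z \<in> ?R"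
      unfolding right_orth_def using zero_object_hom(2)[OF Z] S by (auto simp: zero_object_def)
    with Z show ?thesis by blast
  qed
  have cone: "Cod T v \<in> ?R" if t: "(u, v, w) \<in> Dist T" and X: "Dom T u \<in> ?R" and Y: "Cod T u \<in> ?R" for u v w
  proof -
    note a = dist_arrs[OF t]
    have "arrs T A (Dom T w) = {Zer T A (Dom T w)}" if A: "A \<in> S" for A
    proof (rule hom_zeroI)
      fix f assume f: "f \<in> arrs T A (Dom T w)"
      have "w \<cdot> f = Zer T A (shift (Dom T u))"
        using cmp_arr[OF f a(3)] shift[OF X] A unfolding right_orth_def by auto
      then obtain g where g: "g \<in> arrs T A (Dom T v)" "f = v \<cdot> g"
        using dist_exact_co[OF t f] by blast
      then have "g = Zer T A (Dom T v)"
        using Y A a(4) unfolding right_orth_def by auto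
      then show "f = Zer T A (Dom T w)"
        using g(2) cmp_zer_right[OF a(2)] A S by blast
    qed (use arrs_obj[OF a(3)] A S in auto)
    then show ?thesis
      unfolding right_orth_def using a(5) arrs_obj(1)[OF a(3)] by auto
  qed
  have summand: "summand_closed T ?R"
    unfolding summand_closed_def
  proof (intro ballI allI impI)
    fix X A B \<iota> assume X: "X \<in> ?R" and cp: "is_binary_coproduct T A B X \<iota>"
    obtain p where p: "\<iota> True \<in> arrs T A X" "p \<in> arrs T X A" "p \<cdot> \<iota> True = Idn T A"
      using binary_coproduct_retract[OF cp] by blast
    then show "A \<in> ?R"
      using hom_zero_cod_retract[OF p] X S arrs_obj(1)[OF p(1)] unfolding right_orth_def by blast
  qed
  show ?thesis
    unfolding thick_def triangulated_sub_def
    using replete zero shift unshift cone summand by fast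
qed

text \<open>Exactness at the rotated triangles makes the identities of \<open>?X\<close> and
  \<open>?Y\<close> factor through \<open>?n\<close>, which gives a left and a right inverse. The
  objects are shifted because both exactness lemmas concern the third object of a triangle.\<close>

lemma dist_third_zero_isomorphic:
  assumes t: "(u, v, w) \<in> Dist T" and Z: "zero_object T (Dom T w)"
  shows "isomorphic T (shift (Dom T u)) (shift (Dom T v))"
proof -
  note a = dist_arrs[OF t]
  let ?X = "shift (Dom T u)" and ?Y = "shift (Dom T v)" and ?n = "neg T (ar (Shift T) u)"
  have X: "?X \<in> Obj T" and Y: "?Y \<in> Obj T"
    using arrs_obj[OF a(1)] shift_obj by auto
  have n: "?n \<in> arrs T ?X ?Y"
    by (rule neg_arr[OF functor_arrs[OF shift_functor a(1)]])
  have t1: "(v, w, ?n) \<in> Dist T" by (rule dist_rotate[OF t])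
  have t2: "(w, ?n, neg T (ar (Shift T) v)) \<in> Dist T" by (rule dist_rotate[OF t1])
  have doms: "Dom T ?n = ?X" "Dom T (neg T (ar (Shift T) v)) = ?Y"
    using arrs_obj(4)[OF n] arrs_obj(4)[OF neg_arr[OF functor_arrs[OF shift_functor a(2)]]] by auto
  have W: "Dom T w \<in> Obj T" using arrs_obj(1)[OF a(3)] .
  have "Idn T ?X \<cdot> w = Zer T (Dom T w) ?X"
    using zero_object_hom(1)[OF Z X] cmp_arr[OF a(3) idn_arr[OF X]] by blast
  then obtain g where g: "g \<in> arrs T ?Y ?X" "Idn T ?X = g \<cdot> ?n"
    using dist_exact_contra[OF t1, of "Idn T ?X" ?X] idn_arr[OF X] doms by auto
  have sv: "neg T (ar (Shift T) v) \<in> arrs T ?Y (shift (Dom T w))"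
    by (rule neg_arr[OF functor_arrs[OF shift_functor a(2)]])
  have "neg T (ar (Shift T) v) \<cdot> Idn T ?Y = Zer T ?Y (shift (Dom T w))"
    using zero_object_hom(2)[OF zero_object_shift[OF Z] Y] cmp_arr[OF idn_arr[OF Y] sv] by blast
  then obtain h where h: "h \<in> arrs T ?Y ?X" "Idn T ?Y = ?n \<cdot> h"
    using dist_exact_co[OF t2, of "Idn T ?Y" ?Y] idn_arr[OF Y] doms by auto
  show ?thesis
    using split_mono_split_epi_isomorphic[OF n g(1) h(1)] g(2) h(2) by simp
qed

section \<open>Stable t-structures\<close>

context
  fixes U W :: "'o set"
  assumes ts: "stable_t_structure T U W"
begin

lemma aisle_subset: "U \<subseteq> Obj T"
  using ts unfolding stable_t_structure_def t_structure_def replete_def by blast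

lemma aisle_iso: "\<lbrakk>A \<in> U; isomorphic T A B\<rbrakk> \<Longrightarrow> B \<in> U"
  using ts isomorphic_obj unfolding stable_t_structure_def t_structure_def replete_def by blast

lemma aisle_shift: "A \<in> U \<Longrightarrow> shift A \<in> U"
  using ts aisle_subset isomorphic_refl[OF shift_obj] shift_obj
  unfolding stable_t_structure_def t_structure_def shift_sub_def by blast

lemma aisle_unshift: "A \<in> U \<Longrightarrow> unshift A \<in> U"
  using ts aisle_subset isomorphic_refl[OF unshift_obj] unshift_obj
  unfolding stable_t_structure_def unshift_sub_def by blast

text \<open>The orthogonality axiom places \<open>unshift_sub T W\<close> inside the right
  orthogonal of \<open>U\<close>. From here on the coaisle is always taken to be
  \<open>right_orth T U\<close>.\<close>

lemma truncation_triangle: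
  assumes "X \<in> Obj T"
  obtains u v w where "(u, v, w) \<in> Dist T" "Dom T u \<in> U" "Dom T v = X" "Dom T w \<in> right_orth T U"
proof -
  obtain u v w where t: "(u, v, w) \<in> Dist T" "Dom T u \<in> U" "Dom T v = X" "Cod T v \<in> unshift_sub T W"
    using ts assms unfolding stable_t_structure_def t_structure_def by blast
  moreover have "unshift_sub T W \<subseteq> right_orth T U"
    using ts unfolding stable_t_structure_def t_structure_def right_orth_def unshift_sub_def by blast
  ultimately show thesis
    using that dist_arrs(5) by force
qed

text \<open>If \<open>X \<in> \<^sup>\<bottom>(U\<^sup>\<bottom>)\<close>, then the second arrow of the truncation triangle \<open>A \<rightarrow> X \<rightarrow> B \<rightarrow> A[1]\<close> vanishes,
  so the identity of \<open>B\<close> factors through \<open>A[1] \<in> U\<close> and hence \<open>B = 0\<close>.\<close>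

lemma aisle_eq_left_orth: "U = left_orth (right_orth T U)"
proof
  show "U \<subseteq> left_orth (right_orth T U)"
    using aisle_subset unfolding left_orth_def right_orth_def by blast
  show "left_orth (right_orth T U) \<subseteq> U"
  proof
    fix X assume X: "X \<in> left_orth (right_orth T U)"
    then have XO: "X \<in> Obj T" unfolding left_orth_def by blast
    obtain u v w where t: "(u, v, w) \<in> Dist T" and A: "Dom T u \<in> U" and v: "Dom T v = X"
      and B: "Dom T w \<in> right_orth T U"
      using truncation_triangle[OF XO] .
    note a = dist_arrs[OF t]
    let ?B = "Dom T w"
    have BO: "?B \<in> Obj T" using arrs_obj(1)[OF a(3)] .
    have "Idn T ?B \<cdot> v = Zer T (Dom T v) ?B"
      using cmp_idn_left[OF a(2)] a(2) X B v unfolding left_orth_def by auto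
    then obtain g where g: "g \<in> arrs T (shift (Dom T u)) ?B" "Idn T ?B = g \<cdot> w"
      using dist_exact_contra[OF t idn_arr[OF BO]] by blast
    have "g = Zer T (shift (Dom T u)) ?B"
      using g(1) B aisle_shift[OF A] unfolding right_orth_def by blast
    then have "Idn T ?B = Zer T ?B ?B"
      using g(2) cmp_zer_left[OF a(3) BO] by simp
    then have "zero_object T ?B"
      using zero_object_iff_idn[OF BO] by blast
    then have "isomorphic T (shift (Dom T u)) (shift X)"
      using dist_third_zero_isomorphic[OF t] v by blast
    \<comment> \<open>Only the shifts of \<open>Dom T u\<close> and \<open>X\<close> are known to be
      isomorphic; stability of the aisle permits the descent by \<open>unshift\<close>.\<close>
    then have "unshift (shift X) \<in> U"
      using aisle_iso aisle_shift[OF A] aisle_unshift by blast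
    then show "X \<in> U"
      using aisle_iso isomorphic_sym[OF isomorphic_unshift_shift[OF XO]] by blast
  qed
qed

lemma coaisle_shift: "B \<in> right_orth T U \<Longrightarrow> shift B \<in> right_orth T U"
  using right_orth_shift[OF aisle_subset aisle_unshift] .

lemma coaisle_unshift: "B \<in> right_orth T U \<Longrightarrow> unshift B \<in> right_orth T U"
  using right_orth_unshift[OF aisle_subset aisle_shift] .

lemma coaisle_subset: "right_orth T U \<subseteq> Obj T"
  unfolding right_orth_def by blast

lemma aisle_thick: "thick T U"
proof -
  \<comment> \<open>For the empty family of index sets, closure under coproducts is vacuous and
    localizing means thick.\<close>
  have "localizing {} T (left_orth (right_orth T U))"
  proof (rule left_orth_localizing[OF coaisle_subset])
    fix X assume X: "X \<in> right_orth T U"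
    then have XO: "X \<in> Obj T" using coaisle_subset by blast
    show "\<exists>Y \<in> right_orth T U. isomorphic T X (shift Y)"
      using isomorphic_sym[OF isomorphic_shift_unshift[OF XO]] coaisle_unshift[OF X] by blast
    show "\<exists>Y \<in> right_orth T U. isomorphic T (shift X) Y"
      using isomorphic_refl[OF shift_obj[OF XO]] coaisle_shift[OF X] by blast
  qed
  then show ?thesis
    using aisle_eq_left_orth unfolding localizing_def thick_def by metis
qed

lemma coaisle_thick: "thick T (right_orth T U)"
  using right_orth_thick[OF aisle_subset aisle_shift aisle_unshift] .

end

end

section \<open>Tensor products and internal homs\<close>

context tensor_triangulated_category
begin

lemma tensor_obj: "\<lbrakk>A \<in> Obj T; B \<in> Obj T\<rbrakk> \<Longrightarrow> A \<boxtimes> B \<in> Obj T"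
  using functor_obj[OF tensor_functor, of "(A, B)"] by (simp add: prod_cat_def)

lemma ihom_obj: "\<lbrakk>A \<in> Obj T; B \<in> Obj T\<rbrakk> \<Longrightarrow> ihom T A B \<in> Obj T"
  using functor_obj[OF ihom_functor, of "(A, B)"] by (simp add: prod_cat_def op_cat_def)

lemma tensor_comm: "\<lbrakk>A \<in> Obj T; B \<in> Obj T\<rbrakk> \<Longrightarrow> isomorphic T (A \<boxtimes> B) (B \<boxtimes> A)"
  using nat_iso_isomorphic[OF symm_nat_iso, of "(A, B)"] by (simp add: prod_cat_def)

text \<open>Bijectivity of \<open>Curry\<close> suffices: a Hom group is trivial exactly when it has
  at most one element, and a bijection preserves this.\<close>

lemma hom_zero_curry:
  assumes A: "A \<in> Obj T" and B: "B \<in> Obj T" and D: "D \<in> Obj T"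
  shows "arrs T (A \<boxtimes> B) D = {Zer T (A \<boxtimes> B) D} \<longleftrightarrow>
    arrs T A (ihom T B D) = {Zer T A (ihom T B D)}"
proof -
  have bij: "bij_betw (Curry T A B D) (arrs T (A \<boxtimes> B) D) (arrs T A (ihom T B D))"
    by (rule curry_bij[OF A B D])
  have z: "Zer T (A \<boxtimes> B) D \<in> arrs T (A \<boxtimes> B) D" "Zer T A (ihom T B D) \<in> arrs T A (ihom T B D)"
    using zer_arr tensor_obj ihom_obj A B D by auto
  have sub: "X = {x} \<longleftrightarrow> (\<forall>a \<in> X. \<forall>b \<in> X. a = b)" if "x \<in> X" for x :: 'm and X
    using that by auto
  show ?thesis
    unfolding sub[OF z(1)] sub[OF z(2)]
    unfolding bij_betw_imp_surj_on[OF bij, symmetric]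
    by (simp add: inj_on_eq_iff[OF bij_betw_imp_inj_on[OF bij]] cong: ball_cong)
qed

lemma ihom_shift:
  assumes B: "B \<in> Obj T" and D: "D \<in> Obj T"
  shows "isomorphic T (ihom T B (shift D)) (shift (ihom T B D))"
proof -
  obtain \<phi> where n: "nat_iso T T (comp_fctr (fix_left B (Idn T B) (IHom T)) (Shift T))
      (comp_fctr (Shift T) (fix_left B (Idn T B) (IHom T))) \<phi>"
    using ihom_triangulated_right[OF B] unfolding triangulated_functor_def by blast
  show ?thesis
    using nat_iso_isomorphic[OF n D] by (simp add: comp_fctr_def)
qed

lemma ihom_isomorphic:
  assumes B: "B \<in> Obj T" and iso: "isomorphic T D E"
  shows "isomorphic T (ihom T B D) (ihom T B E)"
proof -
  have F: "is_functor T T (fix_left B (Idn T B) (IHom T))"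
    using ihom_triangulated_right[OF B] unfolding triangulated_functor_def by blast
  show ?thesis
    using functor_isomorphic[OF category_axioms category_axioms F iso] by simp
qed

section \<open>Ideals and coideals relative to a fixed stable t-structure\<close>

context
  fixes U W :: "'o set"
  assumes ts: "stable_t_structure T U W"
begin

text \<open>Membership in \<open>U\<close> is tested by arrows into the coaisle, by
  \<open>aisle_eq_left_orth\<close>; the adjunction moves \<open>B\<close> into the target.\<close>

lemma tensor_aisle_iff:
  assumes A: "A \<in> Obj T" and B: "B \<in> Obj T"
  shows "A \<boxtimes> B \<in> U \<longleftrightarrow>
    (\<forall>D \<in> right_orth T U. arrs T A (ihom T B D) = {Zer T A (ihom T B D)})"
proof -
  have "A \<boxtimes> B \<in> U \<longleftrightarrow> A \<boxtimes> B \<in> left_orth (right_orth T U)"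
    using aisle_eq_left_orth[OF ts] by simp
  also have "\<dots> \<longleftrightarrow> (\<forall>D \<in> right_orth T U. arrs T (A \<boxtimes> B) D = {Zer T (A \<boxtimes> B) D})"
    using tensor_obj[OF A B] unfolding left_orth_def by blast
  also have "\<dots> \<longleftrightarrow> (\<forall>D \<in> right_orth T U. arrs T A (ihom T B D) = {Zer T A (ihom T B D)})"
    using hom_zero_curry[OF A B] coaisle_subset[OF ts] by blast
  finally show ?thesis .
qed

text \<open>This class is the left orthogonal of all \<open>ihom T B D\<close> with \<open>B\<close>
  in the aisle and \<open>D\<close> in the coaisle. Shifts of such an internal hom are absorbed into
  \<open>D\<close>, by stability of the coaisle.\<close>

lemma tensor_aisle_localizing: "localizing \<K>' T {A \<in> Obj T. \<forall>B \<in> U. A \<boxtimes> B \<in> U}"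
proof -
  let ?S = "{ihom T B D | B D. B \<in> U \<and> D \<in> right_orth T U}"
  have UO: "U \<subseteq> Obj T" and VO: "right_orth T U \<subseteq> Obj T"
    using aisle_subset[OF ts] coaisle_subset[OF ts] by auto
  have "localizing \<K>' T (left_orth ?S)"
  proof (rule left_orth_localizing)
    show "?S \<subseteq> Obj T" using ihom_obj UO VO by blast
  next
    fix X assume "X \<in> ?S"
    then obtain B D where X: "X = ihom T B D" and B: "B \<in> U" and D: "D \<in> right_orth T U" by blast
    then have BO: "B \<in> Obj T" and DO: "D \<in> Obj T" using UO VO by auto
    have "isomorphic T X (ihom T B (shift (unshift D)))"
      unfolding X by (rule ihom_isomorphic[OF BO isomorphic_sym[OF isomorphic_shift_unshift[OF DO]]])
    then have "isomorphic T X (shift (ihom T B (unshift D)))"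
      using isomorphic_trans ihom_shift[OF BO unshift_obj[OF DO]] by blast
    then show "\<exists>Y \<in> ?S. isomorphic T X (shift Y)"
      using B coaisle_unshift[OF ts D] by blast
    show "\<exists>Y \<in> ?S. isomorphic T (shift X) Y"
      unfolding X using isomorphic_sym[OF ihom_shift[OF BO DO]] B coaisle_shift[OF ts D] by blast
  qed
  moreover have "left_orth ?S = {A \<in> Obj T. \<forall>B \<in> U. A \<boxtimes> B \<in> U}"
  proof -
    have "(\<forall>X \<in> ?S. arrs T A X = {Zer T A X}) \<longleftrightarrow> (\<forall>B \<in> U. A \<boxtimes> B \<in> U)" if A: "A \<in> Obj T" for A
    proof -
      have "(\<forall>X \<in> ?S. arrs T A X = {Zer T A X}) \<longleftrightarrow>
          (\<forall>B \<in> U. \<forall>D \<in> right_orth T U. arrs T A (ihom T B D) = {Zer T A (ihom T B D)})"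
        by blast
      also have "\<dots> \<longleftrightarrow> (\<forall>B \<in> U. A \<boxtimes> B \<in> U)"
        by (intro ball_cong refl tensor_aisle_iff[symmetric] A) (use UO in blast)
      finally show ?thesis .
    qed
    then show ?thesis
      unfolding left_orth_def by blast
  qed
  ultimately show ?thesis by simp
qed

text \<open>The objects that tensor \<open>U\<close> into itself form a localizing class containing
  \<open>P\<close>, hence contain the whole hull of \<open>P\<close>.\<close>

lemma tensor_ideal_if_generators:
  assumes "\<forall>A \<in> P. \<forall>B \<in> U. A \<boxtimes> B \<in> U" "P \<subseteq> Obj T" "localizing_hull \<K>' T P = Obj T"
  shows "tensor_ideal T U"
proof -
  have "localizing_hull \<K>' T P \<subseteq> {A \<in> Obj T. \<forall>B \<in> U. A \<boxtimes> B \<in> U}"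
    unfolding localizing_hull_def using tensor_aisle_localizing assms(1,2) by blast
  then show ?thesis
    using assms(3) aisle_thick[OF ts] unfolding tensor_ideal_def by blast
qed

lemma tensor_ideal_iff_coideal: "tensor_ideal T U \<longleftrightarrow> tensor_coideal T (right_orth T U)"
proof -
  have UO: "U \<subseteq> Obj T" and VO: "right_orth T U \<subseteq> Obj T"
    using aisle_subset[OF ts] coaisle_subset[OF ts] by auto
  \<comment> \<open>Symmetry puts the aisle object first, so that the adjunction internalises the
    arbitrary object \<open>A\<close>. Thickness is automatic on the aisle side.\<close>
  have "tensor_ideal T U \<longleftrightarrow> (\<forall>A \<in> Obj T. \<forall>B \<in> U. B \<boxtimes> A \<in> U)"
    using aisle_thick[OF ts] aisle_iso[OF ts] tensor_comm UO unfolding tensor_ideal_def by blast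
  also have "\<dots> \<longleftrightarrow> (\<forall>A \<in> Obj T. \<forall>B \<in> U. \<forall>D \<in> right_orth T U.
      arrs T B (ihom T A D) = {Zer T B (ihom T A D)})"
    by (intro ball_cong refl tensor_aisle_iff) (use UO in blast)+
  \<comment> \<open>With \<open>A\<close> and \<open>D\<close> fixed, vanishing for all
    \<open>B\<close> in \<open>U\<close> is precisely orthogonality of \<open>ihom T A D\<close> to
    \<open>U\<close>.\<close>
  also have "\<dots> \<longleftrightarrow> (\<forall>A \<in> Obj T. \<forall>D \<in> right_orth T U. ihom T A D \<in> right_orth T U)"
    using ihom_obj VO unfolding right_orth_def by blast
  finally show ?thesis
    using coaisle_thick[OF ts] unfolding tensor_coideal_def by blast
qed

end

end

theorem proposition2p9:
  fixes \<K> :: "'i set set" and T :: "('o, 'm, 'z) tt_cat_scheme" and P U V :: "'o set"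
  assumes "small_index_sets \<K>"
    and "tensor_triangulated_category \<K> T"
    and "preaisle T P"
    and "\<forall>A \<in> P. \<forall>B \<in> P. A \<boxtimes>\<^bsub>T\<^esub> B \<in> P"
    and "Unit T \<in> P"
    and "localizing_hull \<K> T P = Obj T"
    and "V = right_orth T U"
    and "stable_t_structure T U (shift_sub T V)"
  shows "(stable_t_structure T U (shift_sub T V) \<and> tensor_t_structure T P U (shift_sub T V)
            \<longleftrightarrow> tensor_ideal T U)
       \<and> (tensor_ideal T U \<longleftrightarrow> tensor_coideal T V)"
proof -
  interpret tensor_triangulated_category \<K> T by fact
  note ts = assms(8)
  have P: "P \<subseteq> Obj T"
    using assms(3) unfolding preaisle_def by blast
  have "tensor_ideal T U" if "tensor_t_structure T P U (shift_sub T V)"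
    using tensor_ideal_if_generators[OF ts _ P assms(6)] that unfolding tensor_t_structure_def by blast
  \<comment> \<open>An ideal absorbs tensoring with all objects, in particular with those of
    \<open>P\<close>.\<close>
  moreover have "tensor_t_structure T P U (shift_sub T V)" if "tensor_ideal T U"
    using that ts P unfolding tensor_t_structure_def tensor_ideal_def stable_t_structure_def by blast
  ultimately show ?thesis
    using ts tensor_ideal_iff_coideal[OF ts] assms(7) by blast
qed

end
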